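(* (i) Let $f$ be a continuous surjective self-map of a compact metric space $X$. If $h(f)>0$, then $h_{A}(f)>0$, and thus $h_{A}(\hat f)=+\infty$, for any $A\in\mathcal{S}$. (ii) There exists a sequence $f_{0,\infty}=\{f_n\}_{n=0}^\infty$ of continuous self-maps of $X=[0,1]$ with $h(f_{0,\infty})>0$ but $h_{A}(f_{0,\infty})=h_{A}(\hat f_{0,\infty})=0$ for some $A\in\mathcal{S}$.
   Context: $f_0^n=f_{n-1}\circ\cdots\circ f_0$, $f_0^0=\mathrm{id}$; for a single map $f$ the sequence is constant $f_n=f$. $\mathcal S$ is the set of strictly increasing sequences $A=\{a_i\}_{i\ge1}$ of nonnegative integers. For a compact metric space $Z$ and continuous self-maps $g_{0,\infty}$, $h_A(g_{0,\infty})=\sup_{\mathscr A}\limsup_{n\to\infty}\frac1n\log\mathcal N(\bigvee_{i=1}^n (g_0^{a_i})^{-1}\mathscr A)$ over finite open covers ($\bigvee$ = common refinement, $\mathcal N$ = minimal cardinality of a subcover); the topological entropy is $h(g_{0,\infty})=h_A(g_{0,\infty})$ with $A=\{0,1,2,\dots\}$. $\mathcal M(X)$ is the space of Borel probability measures on $X$ with the weak$^*$ topology (compact metric, e.g. via the Prohorov metric), and $\hat f_n(\mu)(B)=\mu(f_n^{-1}(B))$. *)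

theory Defs
  imports "HOL-Analysis.Analysis" "HOL-Probability.Probability"
begin

fun comp_upto :: "(nat \<Rightarrow> 'a \<Rightarrow> 'a) \<Rightarrow> nat \<Rightarrow> 'a \<Rightarrow> 'a" where
  "comp_upto g 0 = id"
| "comp_upto g (Suc n) = g n \<circ> comp_upto g n"

definition fin_open_covers :: "'a topology \<Rightarrow> 'a set set set" where
  "fin_open_covers T = {U. finite U \<and> (\<forall>V\<in>U. openin T V) \<and> \<Union>U = topspace T}"

definition cover_num :: "'a topology \<Rightarrow> 'a set set \<Rightarrow> nat" where
  "cover_num T C = Min {card V | V. V \<subseteq> C \<and> topspace T \<subseteq> \<Union>V}"

definition join_preimages :: "'a topology \<Rightarrow> (nat \<Rightarrow> 'a \<Rightarrow> 'a) \<Rightarrow> nat \<Rightarrow> 'a set set \<Rightarrow> 'a set set" where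
  "join_preimages T \<phi> n U =
     {topspace T \<inter> (\<Inter>i<n. \<phi> i -` c i) | c. \<forall>i<n. c i \<in> U}"

text \<open>Sequence entropy h_A of a nonautonomous system g on T along A
  (A strictly increasing; the paper's a_1, a_2, ... is A 0, A 1, ...).\<close>
definition seq_entropy :: "'a topology \<Rightarrow> (nat \<Rightarrow> 'a \<Rightarrow> 'a) \<Rightarrow> (nat \<Rightarrow> nat) \<Rightarrow> ereal" where
  "seq_entropy T g A =
     (SUP U\<in>fin_open_covers T.
        limsup (\<lambda>n. ereal (ln (real (cover_num T (join_preimages T (\<lambda>i. comp_upto g (A i)) n U))) / real n)))"

definition top_entropy :: "'a topology \<Rightarrow> (nat \<Rightarrow> 'a \<Rightarrow> 'a) \<Rightarrow> ereal" where
  "top_entropy T g = seq_entropy T g (\<lambda>i. i)"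

definition prob_measures :: "'a::topological_space set \<Rightarrow> 'a measure set" where
  "prob_measures X = {\<mu>. prob_space \<mu> \<and> sets \<mu> = sets (restrict_space borel X)}"

definition weak_star_top :: "'a::topological_space set \<Rightarrow> 'a measure topology" where
  "weak_star_top X = subtopology
     (topology_generated_by {{\<mu>. (\<integral>x. \<phi> x \<partial>\<mu>) \<in> V} | \<phi> V. continuous_on X \<phi> \<and> open (V::real set)})
     (prob_measures X)"

definition induced_map :: "'a::topological_space set \<Rightarrow> ('a \<Rightarrow> 'a) \<Rightarrow> 'a measure \<Rightarrow> 'a measure" where
  "induced_map X f \<mu> = distr \<mu> (restrict_space borel X) f"

end

theory Submission
  imports Defs
begin

text \<open>
  Part (i). Let \<open>\<phi> : X \<rightarrow> [0,1]\<close> be continuous and record an orbit by the times at which \<open>\<phi>\<close> is 0 or 1. If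
  no set of times of positive density is shattered by these partial patterns, then they are covered by
  subexponentially many total patterns. Finitely many such \<open>\<phi>\<close> resolve a given open cover, so
  positive entropy yields one \<open>\<phi>\<close> with shattered sets of density at least \<open>\<delta>\<close>. Averaging over
  translates moves positive density into any sequence A, whence \<open>h_A(f) \<ge> (\<delta>/2) ln 2\<close>. Uniform measures
  on m points of shattered orbits realise all values \<open>0, 1/m, ..., 1\<close> of the integral of \<open>\<phi>\<close>
  independently, so the induced map has sequence entropy at least \<open>(\<delta>/2) ln (m + 1)\<close> for every m.

  Part (ii). Let T be a full three-piece tent map with a plateau. The maps alternately apply T followed by
  a contraction towards 0 and undo the contraction, so that the compositions are \<open>T^i\<close> at time
  \<open>2 i + 1\<close> and \<open>T^i/(i + 1)\<close> at time \<open>2 i\<close>. Along the even times everything collapses to 0.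
\<close>

section \<open>Covering numbers of joins\<close>

lemma finite_join_preimages:
  assumes "finite U"
  shows "finite (join_preimages T \<psi> n U)"
proof -
  have "join_preimages T \<psi> n U \<subseteq>
      (\<lambda>c. topspace T \<inter> (\<Inter>i<n. \<psi> i -` c i)) ` ({..<n} \<rightarrow>\<^sub>E U)"
  proof
    fix S assume "S \<in> join_preimages T \<psi> n U"
    then obtain c where c: "S = topspace T \<inter> (\<Inter>i<n. \<psi> i -` c i)" "\<forall>i<n. c i \<in> U"
      unfolding join_preimages_def by blast
    have "S = topspace T \<inter> (\<Inter>i<n. \<psi> i -` (restrict c {..<n}) i)"
      using c(1) by auto
    moreover have "restrict c {..<n} \<in> {..<n} \<rightarrow>\<^sub>E U" using c(2) by auto
    ultimately show "S \<in> (\<lambda>c. topspace T \<inter> (\<Inter>i<n. \<psi> i -` c i)) ` ({..<n} \<rightarrow>\<^sub>E U)"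
      by blast
  qed
  moreover have "finite ({..<n} \<rightarrow>\<^sub>E U)" using assms by (simp add: finite_PiE)
  ultimately show ?thesis by (meson finite_imageI finite_subset)
qed

lemma cover_num_le_card:
  assumes "finite C" "V \<subseteq> C" "topspace T \<subseteq> \<Union>V"
  shows "cover_num T C \<le> card V"
proof -
  have "finite {card V | V. V \<subseteq> C \<and> topspace T \<subseteq> \<Union>V}"
    using assms(1) by (auto intro: finite_subset[of _ "card ` Pow C"])
  then show ?thesis unfolding cover_num_def using assms by (intro Min_le) auto
qed

lemma cover_num_attained:
  assumes "finite C" "topspace T \<subseteq> \<Union>C"
  obtains V where "V \<subseteq> C" "topspace T \<subseteq> \<Union>V" "card V = cover_num T C"
proof -
  have "finite {card V | V. V \<subseteq> C \<and> topspace T \<subseteq> \<Union>V}"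
    using assms(1) by (auto intro: finite_subset[of _ "card ` Pow C"])
  moreover have "{card V | V. V \<subseteq> C \<and> topspace T \<subseteq> \<Union>V} \<noteq> {}"
    using assms(2) by blast
  ultimately have "cover_num T C \<in> {card V | V. V \<subseteq> C \<and> topspace T \<subseteq> \<Union>V}"
    unfolding cover_num_def by (rule Min_in)
  then show ?thesis using that by auto
qed

lemma join_preimages_covers:
  assumes "topspace T \<subseteq> \<Union>U" "\<And>i z. i < n \<Longrightarrow> z \<in> topspace T \<Longrightarrow> \<psi> i z \<in> topspace T"
  shows "topspace T \<subseteq> \<Union>(join_preimages T \<psi> n U)"
proof
  fix z assume z: "z \<in> topspace T"
  have "\<forall>i. \<exists>V. i < n \<longrightarrow> V \<in> U \<and> \<psi> i z \<in> V"
    using assms z by blast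
  then obtain c where "\<And>i. i < n \<Longrightarrow> c i \<in> U \<and> \<psi> i z \<in> c i" by metis
  then show "z \<in> \<Union>(join_preimages T \<psi> n U)"
    unfolding join_preimages_def using z by blast
qed

section \<open>Lower bounds for covering numbers and sequence entropy\<close>

text \<open>Two distinct points of \<open>Z\<close> never share a member of the join, since such a
  member would put their images into a common member of \<open>U\<close> at every time below
  \<open>n\<close>. A subcover therefore needs a separate member for each point.\<close>

lemma cover_num_ge_card_separated:
  assumes U: "U \<in> fin_open_covers T"
    and maps: "\<And>i z. i < n \<Longrightarrow> z \<in> topspace T \<Longrightarrow> \<psi> i z \<in> topspace T"
    and Z: "Z \<subseteq> topspace T"
    and sep: "\<And>z z'. z \<in> Z \<Longrightarrow> z' \<in> Z \<Longrightarrow> z \<noteq> z' \<Longrightarrow>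
                \<exists>i<n. \<forall>V\<in>U. \<not> (\<psi> i z \<in> V \<and> \<psi> i z' \<in> V)"
  shows "card Z \<le> cover_num T (join_preimages T \<psi> n U)"
proof -
  have fin: "finite (join_preimages T \<psi> n U)"
    using U by (simp add: fin_open_covers_def finite_join_preimages)
  have "topspace T \<subseteq> \<Union>(join_preimages T \<psi> n U)"
    using U maps by (intro join_preimages_covers) (auto simp: fin_open_covers_def)
  then obtain V where V: "V \<subseteq> join_preimages T \<psi> n U" "topspace T \<subseteq> \<Union>V"
    "card V = cover_num T (join_preimages T \<psi> n U)"
    using cover_num_attained[OF fin] by blast
  have "\<forall>z\<in>Z. \<exists>S\<in>V. z \<in> S" using Z V(2) by blast
  then obtain g where g: "\<And>z. z \<in> Z \<Longrightarrow> g z \<in> V \<and> z \<in> g z" by metis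
  have "inj_on g Z"
  proof (rule inj_onI, rule ccontr)
    fix z z' assume zz: "z \<in> Z" "z' \<in> Z" "g z = g z'" "z \<noteq> z'"
    obtain c where "g z = topspace T \<inter> (\<Inter>i<n. \<psi> i -` c i)" "\<forall>i<n. c i \<in> U"
      using g[OF zz(1)] V(1) unfolding join_preimages_def by blast
    moreover obtain i where "i < n" "\<forall>V\<in>U. \<not> (\<psi> i z \<in> V \<and> \<psi> i z' \<in> V)"
      using sep[OF zz(1,2,4)] by blast
    ultimately show False using g[OF zz(1)] g[OF zz(2)] unfolding zz(3)[symmetric] by blast
  qed
  then have "card Z \<le> card V"
    using g finite_subset[OF V(1) fin] by (intro card_inj_on_le[of g]) auto
  then show ?thesis using V(3) by simp
qed

text \<open>After rescaling by \<open>m\<close> these are intervals of radius 1 about the integers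
  from 0 to \<open>m\<close>. They overlap enough to cover, yet an integer value lies only in the
  interval about itself, so an open cover separates exact levels.\<close>

definition level_cover :: "'b topology \<Rightarrow> ('b \<Rightarrow> real) \<Rightarrow> nat \<Rightarrow> 'b set set" where
  "level_cover T h m =
     (\<lambda>r. {z \<in> topspace T. real m * h z \<in> {real r - 1 <..< real r + 1}}) ` {..m}"

lemma level_cover_in_fin_open_covers:
  assumes "continuous_map T euclideanreal h" "\<And>z. z \<in> topspace T \<Longrightarrow> 0 \<le> h z \<and> h z \<le> 1"
  shows "level_cover T h m \<in> fin_open_covers T"
proof -
  have cont: "continuous_map T euclideanreal (\<lambda>z. real m * h z)"
    using assms(1) by (intro continuous_map_real_mult) auto
  have "openin T V" if "V \<in> level_cover T h m" for V
    using that unfolding level_cover_def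
    by (auto intro!: openin_continuous_map_preimage[OF cont, of "{_<..<_}", simplified])
  moreover have "topspace T \<subseteq> \<Union>(level_cover T h m)"
  proof
    fix z assume z: "z \<in> topspace T"
    define r where "r = nat \<lfloor>real m * h z\<rfloor>"
    have "0 \<le> real m * h z" "real m * h z \<le> real m"
      using assms(2)[OF z] by (auto simp: mult_left_le)
    then have r: "r \<le> m" "real r \<le> real m * h z" "real m * h z < real r + 1"
      unfolding r_def by linarith+
    show "z \<in> \<Union>(level_cover T h m)"
      unfolding level_cover_def using r z by (auto intro!: bexI[of _ r])
  qed
  ultimately show ?thesis
    unfolding fin_open_covers_def by (auto simp: level_cover_def)
qed

text \<open>One point is chosen for each assignment of levels to \<open>J\<close>. Two different
  assignments disagree at some time of \<open>J\<close>, and no member of the level cover contains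
  both levels, so the chosen points are separated.\<close>

lemma cover_num_level_cover_ge:
  assumes cont: "continuous_map T euclideanreal h"
    and bnd: "\<And>z. z \<in> topspace T \<Longrightarrow> 0 \<le> h z \<and> h z \<le> 1"
    and maps: "\<And>i z. i < n \<Longrightarrow> z \<in> topspace T \<Longrightarrow> \<psi> i z \<in> topspace T"
    and J: "J \<subseteq> {..<n}" and m: "0 < m"
    and indep: "\<And>v. v \<in> J \<rightarrow>\<^sub>E {..m} \<Longrightarrow>
       \<exists>z\<in>topspace T. \<forall>j\<in>J. real m * h (\<psi> j z) = real (v j)"
  shows "(m + 1) ^ card J \<le> cover_num T (join_preimages T \<psi> n (level_cover T h m))"
proof -
  have "\<forall>v\<in>J \<rightarrow>\<^sub>E {..m}. \<exists>z. z \<in> topspace T \<and> (\<forall>j\<in>J. real m * h (\<psi> j z) = real (v j))"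
    using indep by blast
  then obtain \<zeta> where \<zeta>: "\<And>v. v \<in> J \<rightarrow>\<^sub>E {..m} \<Longrightarrow> \<zeta> v \<in> topspace T"
    "\<And>v j. v \<in> J \<rightarrow>\<^sub>E {..m} \<Longrightarrow> j \<in> J \<Longrightarrow> real m * h (\<psi> j (\<zeta> v)) = real (v j)"
    by metis
  have diff: "\<exists>j\<in>J. v j \<noteq> v' j" if "v \<in> J \<rightarrow>\<^sub>E {..m}" "v' \<in> J \<rightarrow>\<^sub>E {..m}" "v \<noteq> v'" for v v'
    using that by (meson PiE_ext)
  have inj: "inj_on \<zeta> (J \<rightarrow>\<^sub>E {..m})"
    using diff \<zeta>(2) by (intro inj_onI) (metis of_nat_eq_iff)
  have "finite J" using J finite_subset by blast
  then have "(m + 1) ^ card J = card (\<zeta> ` (J \<rightarrow>\<^sub>E {..m}))"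
    by (simp add: card_image[OF inj] card_PiE)
  also have "\<dots> \<le> cover_num T (join_preimages T \<psi> n (level_cover T h m))"
  proof (rule cover_num_ge_card_separated)
    show "level_cover T h m \<in> fin_open_covers T"
      using cont bnd by (rule level_cover_in_fin_open_covers)
    show "\<zeta> ` (J \<rightarrow>\<^sub>E {..m}) \<subseteq> topspace T" using \<zeta>(1) by blast
    fix z z' assume "z \<in> \<zeta> ` (J \<rightarrow>\<^sub>E {..m})" "z' \<in> \<zeta> ` (J \<rightarrow>\<^sub>E {..m})" "z \<noteq> z'"
    then obtain v v' where v: "v \<in> J \<rightarrow>\<^sub>E {..m}" "v' \<in> J \<rightarrow>\<^sub>E {..m}" "v \<noteq> v'" "z = \<zeta> v" "z' = \<zeta> v'"
      by blast
    obtain j where j: "j \<in> J" "v j \<noteq> v' j" using diff v by blast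
    have "\<not> (\<psi> j z \<in> V \<and> \<psi> j z' \<in> V)" if V: "V \<in> level_cover T h m" for V
    proof
      assume "\<psi> j z \<in> V \<and> \<psi> j z' \<in> V"
      then obtain r :: nat where "real r - 1 < real (v j)" "real (v j) < real r + 1"
        "real r - 1 < real (v' j)" "real (v' j) < real r + 1"
        using V \<zeta>(2)[OF v(1) j(1)] \<zeta>(2)[OF v(2) j(1)] v(4,5)
        unfolding level_cover_def by auto
      then have "v j = r" "v' j = r" by linarith+
      then show False using j(2) by simp
    qed
    then show "\<exists>i<n. \<forall>V\<in>level_cover T h m. \<not> (\<psi> i z \<in> V \<and> \<psi> i z' \<in> V)"
      using j J by blast
  qed (use maps in auto)
  finally show ?thesis .
qed

text \<open>Free choice among \<open>m + 1\<close> levels on times of density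
  \<open>\<delta>\<close> forces the covering numbers to grow at rate
  \<open>\<delta> * ln (m + 1)\<close>. The case \<open>m = 1\<close> serves for maps on points,
  arbitrary \<open>m\<close> for maps on measures.\<close>

lemma seq_entropy_ge:
  assumes cont: "continuous_map T euclideanreal h"
    and bnd: "\<And>z. z \<in> topspace T \<Longrightarrow> 0 \<le> h z \<and> h z \<le> 1"
    and maps: "\<And>i z. z \<in> topspace T \<Longrightarrow> comp_upto g i z \<in> topspace T"
    and m: "0 < m"
    and indep: "\<forall>\<^sub>F n in sequentially. \<exists>J\<subseteq>{..<n}. \<delta> * real n \<le> real (card J) \<and>
       (\<forall>v\<in>J \<rightarrow>\<^sub>E {..m}. \<exists>z\<in>topspace T. \<forall>j\<in>J. real m * h (comp_upto g (A j) z) = real (v j))"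
  shows "ereal (\<delta> * ln (real m + 1)) \<le> seq_entropy T g A"
proof -
  let ?a = "\<lambda>n. ereal (ln (real (cover_num T (join_preimages T (\<lambda>i. comp_upto g (A i)) n
     (level_cover T h m)))) / real n)"
  have "\<forall>\<^sub>F n in sequentially. ereal (\<delta> * ln (real m + 1)) \<le> ?a n"
    using indep eventually_gt_at_top[of 0]
  proof eventually_elim
    case (elim n)
    then obtain J where J: "J \<subseteq> {..<n}" "\<delta> * real n \<le> real (card J)"
      "\<And>v. v \<in> J \<rightarrow>\<^sub>E {..m} \<Longrightarrow>
         \<exists>z\<in>topspace T. \<forall>j\<in>J. real m * h (comp_upto g (A j) z) = real (v j)" by blast
    let ?N = "cover_num T (join_preimages T (\<lambda>i. comp_upto g (A i)) n (level_cover T h m))"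
    have "(m + 1) ^ card J \<le> ?N"
      using cover_num_level_cover_ge[of T h n "\<lambda>i. comp_upto g (A i)", OF cont bnd maps J(1) m J(3)]
      by simp
    then have "real ((m + 1) ^ card J) \<le> real ?N" by (rule of_nat_mono)
    then have N: "(real m + 1) ^ card J \<le> real ?N" by (simp add: add.commute)
    have "\<delta> * real n * ln (real m + 1) \<le> real (card J) * ln (real m + 1)"
      using J(2) by (intro mult_right_mono) auto
    also have "\<dots> = ln ((real m + 1) ^ card J)" by (simp add: ln_realpow)
    also have "\<dots> \<le> ln (real ?N)" using N by (intro ln_mono) auto
    finally show ?case using elim by (simp add: field_simps)
  qed
  then have "ereal (\<delta> * ln (real m + 1)) \<le> limsup ?a"
    by (intro le_Limsup) auto
  also have "\<dots> \<le> seq_entropy T g A"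
    unfolding seq_entropy_def by (rule SUP_upper) (rule level_cover_in_fin_open_covers[OF cont bnd])
  finally show ?thesis .
qed

section \<open>Vanishing sequence entropy\<close>

text \<open>Once a single member of the cover contains the whole image, later coordinates of the
  join leave no choice to be made. Finitely many coordinates remain, so the covering numbers stay
  bounded in \<open>n\<close>.\<close>

lemma seq_entropy_eq_0_if_eventually_subordinate:
  assumes maps: "\<And>i z. z \<in> topspace T \<Longrightarrow> comp_upto g i z \<in> topspace T"
    and sub: "\<And>U. U \<in> fin_open_covers T \<Longrightarrow>
      \<forall>\<^sub>F i in sequentially. \<exists>V\<in>U. comp_upto g (A i) ` topspace T \<subseteq> V"
  shows "seq_entropy T g A = 0"
proof -
  have "limsup (\<lambda>n. ereal (ln (real (cover_num T (join_preimages T (\<lambda>i. comp_upto g (A i)) n U))) / real n)) = 0"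
    if U: "U \<in> fin_open_covers T" for U
  proof -
    let ?\<psi> = "\<lambda>i. comp_upto g (A i)"
    let ?N = "\<lambda>n. cover_num T (join_preimages T ?\<psi> n U)"
    have finU: "finite U" and covU: "topspace T \<subseteq> \<Union>U"
      using U by (auto simp: fin_open_covers_def)
    obtain i0 where "\<forall>i\<ge>i0. \<exists>V\<in>U. ?\<psi> i ` topspace T \<subseteq> V"
      using sub[OF U] unfolding eventually_sequentially by blast
    then obtain V where V: "\<And>i. i \<ge> i0 \<Longrightarrow> V i \<in> U \<and> ?\<psi> i ` topspace T \<subseteq> V i" by metis
    define B where "B = card ({..<i0} \<rightarrow>\<^sub>E U)"
    have N: "?N n \<le> B" for n
    proof -
      \<comment> \<open>Members are chosen freely before time \<open>i0\<close> and are the fixed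
        \<open>V i\<close> from then on, so \<open>B\<close> bounds the number of choices for every
        \<open>n\<close>.\<close>
      define D where "D = (\<lambda>c. topspace T \<inter> (\<Inter>i<n. ?\<psi> i -` (if i < i0 then c i else V i))) ` ({..<i0} \<rightarrow>\<^sub>E U)"
      have fin: "finite ({..<i0} \<rightarrow>\<^sub>E U)" using finU by (simp add: finite_PiE)
      have "?N n \<le> card D"
      proof (rule cover_num_le_card)
        show "finite (join_preimages T ?\<psi> n U)" using finU by (rule finite_join_preimages)
        show "D \<subseteq> join_preimages T ?\<psi> n U"
        proof
          fix S assume "S \<in> D"
          then obtain c where c: "c \<in> {..<i0} \<rightarrow>\<^sub>E U"
            "S = topspace T \<inter> (\<Inter>i<n. ?\<psi> i -` (if i < i0 then c i else V i))"
            unfolding D_def by blast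
          then have "\<forall>i<n. (if i < i0 then c i else V i) \<in> U"
            using V by (auto simp: not_less)
          then show "S \<in> join_preimages T ?\<psi> n U"
            unfolding join_preimages_def c(2)
            by (intro CollectI exI[of _ "\<lambda>i. if i < i0 then c i else V i"]) auto
        qed
        show "topspace T \<subseteq> \<Union>D"
        proof
          fix z assume z: "z \<in> topspace T"
          have "\<forall>i. \<exists>S\<in>U. ?\<psi> i z \<in> S" using maps[OF z] covU by blast
          then obtain c where c: "\<And>i. c i \<in> U \<and> ?\<psi> i z \<in> c i" by metis
          have "z \<in> topspace T \<inter> (\<Inter>i<n. ?\<psi> i -` (if i < i0 then restrict c {..<i0} i else V i))"
            using z c V by (auto simp: not_less)
          moreover have "restrict c {..<i0} \<in> {..<i0} \<rightarrow>\<^sub>E U" using c by auto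
          ultimately show "z \<in> \<Union>D" unfolding D_def by blast
        qed
      qed
      also have "\<dots> \<le> B" unfolding D_def B_def by (rule card_image_le[OF fin])
      finally show ?thesis .
    qed
    \<comment> \<open>On an empty space the covering number is 0 and \<open>ln 0 = 0\<close>; the
      \<open>+ 1\<close> keeps the upper bound nonnegative in that case.\<close>
    have lnN: "0 \<le> ln (real (?N n))" "ln (real (?N n)) \<le> ln (real B + 1)" for n
    proof -
      show "0 \<le> ln (real (?N n))" by (cases "?N n") auto
      show "ln (real (?N n)) \<le> ln (real B + 1)"
        using N[of n] by (cases "?N n = 0") (auto intro!: ln_mono)
    qed
    have "(\<lambda>n. ln (real (?N n)) / real n) \<longlonglongrightarrow> 0"
    proof (rule tendsto_sandwich[where f = "\<lambda>_. 0"])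
      show "(\<lambda>n. ln (real B + 1) / real n) \<longlonglongrightarrow> 0" by (rule lim_const_over_n)
      show "\<forall>\<^sub>F n in sequentially. ln (real (?N n)) / real n \<le> ln (real B + 1) / real n"
        using lnN by (intro always_eventually allI divide_right_mono) auto
    qed (use lnN in auto)
    then have "(\<lambda>n. ereal (ln (real (?N n)) / real n)) \<longlonglongrightarrow> ereal 0"
      by (rule tendsto_ereal)
    then show ?thesis using lim_imp_Limsup[OF sequentially_bot] by (metis zero_ereal_def)
  qed
  \<comment> \<open>This cover makes the index set of the supremum nonempty, so that the supremum is
    0 and not the bottom element.\<close>
  moreover have "{topspace T} \<in> fin_open_covers T" by (simp add: fin_open_covers_def)
  ultimately show ?thesis
    unfolding seq_entropy_def
    by (intro antisym SUP_least SUP_upper2[where i = "{topspace T}"]) simp_all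
qed

section \<open>Shattered sets and covers of partial patterns\<close>

text \<open>Vapnik-Chervonenkis shattering for partial patterns: a point may satisfy neither
  predicate at a given time. The empty set is shattered exactly when \<open>E\<close> is
  nonempty.\<close>

definition shattered :: "(nat \<Rightarrow> 'b \<Rightarrow> bool) \<Rightarrow> (nat \<Rightarrow> 'b \<Rightarrow> bool) \<Rightarrow> 'b set \<Rightarrow> nat set \<Rightarrow> bool" where
  "shattered P Q E J \<longleftrightarrow> (\<forall>K\<subseteq>J. \<exists>x\<in>E. (\<forall>j\<in>K. Q j x) \<and> (\<forall>j\<in>J - K. P j x))"

lemma shattered_mono: "shattered P Q E J \<Longrightarrow> E \<subseteq> E' \<Longrightarrow> shattered P Q E' J"
  unfolding shattered_def by (meson subsetD)

text \<open>A set shattered by one of the two halves omits \<open>i\<close>, where all points of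
  that half have the same value. If both halves shatter \<open>J\<close>, then \<open>E\<close>
  shatters \<open>J\<close> as well as \<open>insert i J\<close>, so every set counted twice on the
  left is matched by an additional set containing \<open>i\<close>.\<close>

lemma card_shattered_split:
  assumes disj: "\<And>i x. \<not> (P i x \<and> Q i x)" and i: "i < n"
  shows "card {J. J \<subseteq> {..<n} \<and> shattered P Q {x\<in>E. P i x} J} +
         card {J. J \<subseteq> {..<n} \<and> shattered P Q {x\<in>E. Q i x} J}
       \<le> card {J. J \<subseteq> {..<n} \<and> shattered P Q E J}" (is "card ?A + card ?B \<le> card ?C")
proof -
  have fin: "finite ?A" "finite ?B" "finite ?C"
    by (auto intro: finite_subset[of _ "Pow {..<n}"])
  have notA: "i \<notin> J" if "J \<in> ?A" for J
  proof
    assume "i \<in> J"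
    have "shattered P Q {x\<in>E. P i x} J" using that by simp
    then have "\<exists>x\<in>{x\<in>E. P i x}. \<forall>j\<in>J. Q j x"
      unfolding shattered_def by (blast dest: spec[of _ J])
    then show False using \<open>i \<in> J\<close> disj by blast
  qed
  have notB: "i \<notin> J" if "J \<in> ?B" for J
  proof
    assume "i \<in> J"
    have "shattered P Q {x\<in>E. Q i x} J" using that by simp
    then have "\<exists>x\<in>{x\<in>E. Q i x}. \<forall>j\<in>J. P j x"
      unfolding shattered_def by (metis Diff_empty empty_subsetI)
    then show False using \<open>i \<in> J\<close> disj by blast
  qed
  have ins: "insert i J \<in> ?C" if J: "J \<in> ?A \<inter> ?B" for J
  proof -
    have "shattered P Q E (insert i J)"
      unfolding shattered_def
    proof (intro allI impI)
      fix K assume K: "K \<subseteq> insert i J"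
      show "\<exists>x\<in>E. (\<forall>j\<in>K. Q j x) \<and> (\<forall>j\<in>insert i J - K. P j x)"
      proof (cases "i \<in> K")
        case True
        have "K - {i} \<subseteq> J" using K by blast
        moreover have "shattered P Q {x\<in>E. Q i x} J" using J by simp
        ultimately obtain x where "x \<in> E" "Q i x" "\<forall>j\<in>K - {i}. Q j x" "\<forall>j\<in>J - (K - {i}). P j x"
          unfolding shattered_def by (auto dest!: spec[of _ "K - {i}"])
        then show ?thesis using True by (intro bexI[of _ x]) auto
      next
        case False
        then have "K \<subseteq> J" using K by blast
        moreover have "shattered P Q {x\<in>E. P i x} J" using J by simp
        ultimately obtain x where "x \<in> E" "P i x" "\<forall>j\<in>K. Q j x" "\<forall>j\<in>J - K. P j x"
          unfolding shattered_def by (auto dest!: spec[of _ K])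
        then show ?thesis by (intro bexI[of _ x]) auto
      qed
    qed
    then show ?thesis using J i by auto
  qed
  have "inj_on (insert i) (?A \<inter> ?B)"
  proof (rule inj_onI)
    fix J K assume JK: "J \<in> ?A \<inter> ?B" "K \<in> ?A \<inter> ?B" "insert i J = insert i K"
    have "i \<notin> J" "i \<notin> K" using notA JK by auto
    then show "J = K" using JK(3) by (simp add: insert_ident)
  qed
  then have "card (?A \<inter> ?B) = card (insert i ` (?A \<inter> ?B))" by (simp add: card_image)
  then have "card ?A + card ?B = card (?A \<union> ?B) + card (insert i ` (?A \<inter> ?B))"
    using card_Un_Int[OF fin(1,2)] by simp
  also have "\<dots> = card ((?A \<union> ?B) \<union> insert i ` (?A \<inter> ?B))"
  proof (rule card_Un_disjoint[symmetric])
    show "(?A \<union> ?B) \<inter> insert i ` (?A \<inter> ?B) = {}" using notA notB by blast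
  qed (use fin in auto)
  also have "\<dots> \<le> card ?C"
  proof (rule card_mono[OF fin(3)])
    have "?A \<union> ?B \<subseteq> ?C" using shattered_mono[of P Q _ _ E] by blast
    then show "(?A \<union> ?B) \<union> insert i ` (?A \<inter> ?B) \<subseteq> ?C" using ins by blast
  qed
  finally show ?thesis .
qed

lemma card_shattered_mono:
  assumes "n \<le> n'" "E \<subseteq> E'"
  shows "card {J. J \<subseteq> {..<n} \<and> shattered P Q E J} \<le> card {J. J \<subseteq> {..<n'} \<and> shattered P Q E' J}"
proof (rule card_mono)
  have "{..<n} \<subseteq> {..<n'}" using assms(1) by auto
  then show "{J. J \<subseteq> {..<n} \<and> shattered P Q E J} \<subseteq> {J. J \<subseteq> {..<n'} \<and> shattered P Q E' J}"
    using shattered_mono[OF _ assms(2), of P Q] by (intro Collect_mono) (metis subset_trans)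
  show "finite {J. J \<subseteq> {..<n'} \<and> shattered P Q E' J}"
    by (rule finite_subset[of _ "Pow {..<n'}"]) auto
qed

text \<open>A subset w of \<open>{..<n}\<close> encodes a total pattern. Guessing at each coordinate the value that
  leaves the larger number of shattered sets, every wrong guess halves that number, so a pattern is
  determined by at most k positions of wrong guesses.\<close>
lemma small_cover_of_patterns:
  assumes disj: "\<And>i x. \<not> (P i x \<and> Q i x)"
  shows "card {J. J \<subseteq> {..<n} \<and> shattered P Q E J} < 2 ^ Suc k \<Longrightarrow>
    \<exists>W\<subseteq>Pow {..<n}. card W \<le> (\<Sum>j\<le>k. n choose j) \<and>
      (\<forall>x\<in>E. \<exists>w\<in>W. \<forall>i<n. if i \<in> w then \<not> P i x else \<not> Q i x)"
proof (induction n arbitrary: E k)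
  case 0
  show ?case
    by (rule exI[of _ "{{}}"]) (simp add: sum.atMost_shift)
next
  case (Suc n)
  define s where "s = (\<lambda>n E. card {J. J \<subseteq> {..<n} \<and> shattered P Q E J})"
  define EP where "EP = {x\<in>E. P n x}"
  define EQ where "EQ = {x\<in>E. Q n x}"
  have smono: "s n E1 \<le> s (Suc n) E2" if "E1 \<subseteq> E2" for E1 E2
    unfolding s_def using card_shattered_mono that by (metis le_add2 plus_1_eq_Suc)
  have "s (Suc n) EP + s (Suc n) EQ \<le> s (Suc n) E"
    unfolding s_def EP_def EQ_def using card_shattered_split[OF disj, of n "Suc n"] by simp
  then have split: "s n EP + s n EQ < 2 ^ Suc k"
    using smono[of EP EP] smono[of EQ EQ] Suc.prems unfolding s_def by simp
  have whole: "s n E' < 2 ^ Suc k" if "E' \<subseteq> E" for E'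
    using smono[OF that] Suc.prems unfolding s_def by simp
  define cov where "cov = (\<lambda>E' n W. \<forall>x\<in>E'. \<exists>w\<in>W. \<forall>i<n. if i \<in> w then \<not> P i x else \<not> Q i x)"
  \<comment> \<open>This treats the points on which the guess is wrong: the count has halved, so
    \<open>k\<close> drops by one. By Pascal's rule the bounds for the wrong and the right guess add
    up to the sum for \<open>Suc n\<close>.\<close>
  have minor: "\<exists>W\<subseteq>Pow {..<n}. card W + (\<Sum>j\<le>k. n choose j) \<le> (\<Sum>j\<le>k. Suc n choose j) \<and> cov E' n W"
    if small: "s n E' < 2 ^ k" for E'
  proof (cases k)
    case 0
    then have "s n E' = 0" using small by simp
    \<comment> \<open>Every nonempty set shatters the empty set, so a zero count leaves no
      points.\<close>
    then have "\<not> shattered P Q E' {}" unfolding s_def by auto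
    then have "E' = {}" unfolding shattered_def by auto
    then show ?thesis using 0 by (intro exI[of _ "{}"]) (auto simp: cov_def)
  next
    case (Suc k')
    then obtain W where W: "W \<subseteq> Pow {..<n}" "card W \<le> (\<Sum>j\<le>k'. n choose j)" "cov E' n W"
      using Suc.IH[of E' k'] small unfolding s_def cov_def by auto
    have "(\<Sum>j\<le>k. Suc n choose j) = 1 + (\<Sum>j\<le>k'. (n choose j) + (n choose Suc j))"
      unfolding Suc by (subst sum.atMost_Suc_shift) simp
    also have "\<dots> = (\<Sum>j\<le>k'. n choose j) + (\<Sum>j\<le>k. n choose j)"
      unfolding Suc by (simp add: sum.distrib sum.atMost_Suc_shift[of "(choose) n" k'] del: sum.atMost_Suc)
    finally show ?thesis using W by (intro exI[of _ W]) auto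
  qed
  have combine: "card (W1 \<union> insert n ` W2) \<le> card W1 + card W2"
    if "W2 \<subseteq> Pow {..<n}" for W1 W2 :: "nat set set"
    by (rule order_trans[OF card_Un_le])
      (use that in \<open>auto intro!: card_image_le finite_subset[OF that]\<close>)
  \<comment> \<open>A half with count below \<open>2 ^ k\<close> plays the part of the wrong guess.
    Its complement in \<open>E\<close>, which also holds the points with neither value at
    \<open>n\<close>, keeps the budget \<open>k\<close> and is given the guessed value
    there.\<close>
  have "s n EP < 2 ^ k \<or> s n EQ < 2 ^ k" using split by auto
  then show ?case
  proof
    assume "s n EQ < 2 ^ k"
    then obtain W2 where W2: "W2 \<subseteq> Pow {..<n}"
      "card W2 + (\<Sum>j\<le>k. n choose j) \<le> (\<Sum>j\<le>k. Suc n choose j)" "cov EQ n W2"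
      using minor by blast
    obtain W1 where W1: "W1 \<subseteq> Pow {..<n}" "card W1 \<le> (\<Sum>j\<le>k. n choose j)" "cov (E - EQ) n W1"
      using Suc.IH[of "E - EQ" k] whole[of "E - EQ"] unfolding s_def cov_def by auto
    have "\<exists>w\<in>W1 \<union> insert n ` W2. \<forall>i<Suc n. if i \<in> w then \<not> P i x else \<not> Q i x" if x: "x \<in> E" for x
    proof (cases "Q n x")
      case True
      then obtain w where w: "w \<in> W2" "\<forall>i<n. if i \<in> w then \<not> P i x else \<not> Q i x"
        using W2(3) x unfolding cov_def EQ_def by blast
      then show ?thesis using True disj[of n x]
        by (intro bexI[of _ "insert n w"]) (auto simp: less_Suc_eq)
    next
      case False
      then obtain w where w: "w \<in> W1" "\<forall>i<n. if i \<in> w then \<not> P i x else \<not> Q i x"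
        using W1(3) x unfolding cov_def EQ_def by blast
      moreover have "n \<notin> w" using w W1(1) by auto
      ultimately show ?thesis using False by (intro bexI[of _ w]) (auto simp: less_Suc_eq)
    qed
    then show ?thesis
      using combine[OF W2(1), of W1] W1 W2
      by (intro exI[of _ "W1 \<union> insert n ` W2"] conjI) (force simp: less_Suc_eq, linarith, blast)
  next
    assume "s n EP < 2 ^ k"
    then obtain W1 where W1: "W1 \<subseteq> Pow {..<n}"
      "card W1 + (\<Sum>j\<le>k. n choose j) \<le> (\<Sum>j\<le>k. Suc n choose j)" "cov EP n W1"
      using minor by blast
    obtain W2 where W2: "W2 \<subseteq> Pow {..<n}" "card W2 \<le> (\<Sum>j\<le>k. n choose j)" "cov (E - EP) n W2"
      using Suc.IH[of "E - EP" k] whole[of "E - EP"] unfolding s_def cov_def by auto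
    have "\<exists>w\<in>W1 \<union> insert n ` W2. \<forall>i<Suc n. if i \<in> w then \<not> P i x else \<not> Q i x" if x: "x \<in> E" for x
    proof (cases "P n x")
      case False
      then obtain w where w: "w \<in> W2" "\<forall>i<n. if i \<in> w then \<not> P i x else \<not> Q i x"
        using W2(3) x unfolding cov_def EP_def by blast
      then show ?thesis using False
        by (intro bexI[of _ "insert n w"]) (auto simp: less_Suc_eq)
    next
      case True
      then obtain w where w: "w \<in> W1" "\<forall>i<n. if i \<in> w then \<not> P i x else \<not> Q i x"
        using W1(3) x unfolding cov_def EP_def by blast
      moreover have "n \<notin> w" using w W1(1) by auto
      ultimately show ?thesis using True disj[of n x] by (intro bexI[of _ w]) (auto simp: less_Suc_eq)
    qed
    then show ?thesis
      using combine[OF W2(1), of W1] W1 W2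
      by (intro exI[of _ "W1 \<union> insert n ` W2"] conjI) (force simp: less_Suc_eq, linarith, blast)
  qed
qed

section \<open>Counting sets of small density\<close>

text \<open>Exponential Markov bound: for \<open>0 < t \<le> 1\<close> the sum up to
  \<open>k\<close>, multiplied by \<open>t ^ k\<close>, is at most \<open>(1 + t) ^ n\<close>, hence
  at most \<open>exp (t * n)\<close>. With \<open>t \<le> c / 2\<close> it remains to take
  \<open>\<kappa>\<close> so small that \<open>(1 / t) ^ k\<close> is at most
  \<open>exp (c / 2 * n)\<close>.\<close>

lemma binomial_tail_small:
  assumes "0 < (c::real)"
  obtains \<kappa> where "0 < \<kappa>"
    "\<And>n. real (\<Sum>j\<le>nat \<lfloor>\<kappa> * real n\<rfloor>. n choose j) \<le> exp (c * real n)"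
proof -
  define t where "t = min 1 (c / 2)"
  have t: "0 < t" "t \<le> 1" "t \<le> c / 2" using assms by (auto simp: t_def)
  define L where "L = ln (1 / t)"
  have L: "0 \<le> L" "exp L = 1 / t" using t by (auto simp: L_def)
  \<comment> \<open>The cap at 1 gives \<open>k \<le> n\<close>; the denominator stays positive even
    for \<open>t = 1\<close>, where \<open>L = 0\<close>.\<close>
  define \<kappa> where "\<kappa> = min 1 (c / 2 / (1 + L))"
  have \<kappa>: "0 < \<kappa>" "\<kappa> \<le> 1" using assms L by (auto simp: \<kappa>_def)
  have "\<kappa> * L \<le> c / 2 / (1 + L) * (1 + L)"
    using L \<kappa> assms by (intro mult_mono) (auto simp: \<kappa>_def)
  also have "\<dots> = c / 2" using L(1) by (intro nonzero_eq_divide_eq[THEN iffD1]) auto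
  finally have \<kappa>L: "\<kappa> * L \<le> c / 2" .
  have "real (\<Sum>j\<le>nat \<lfloor>\<kappa> * real n\<rfloor>. n choose j) \<le> exp (c * real n)" for n
  proof -
    define k where "k = nat \<lfloor>\<kappa> * real n\<rfloor>"
    have k: "real k \<le> \<kappa> * real n" using \<kappa> by (simp add: k_def)
    moreover have "\<kappa> * real n \<le> real n" using \<kappa> by (simp add: mult_left_le_one_le)
    ultimately have kn: "k \<le> n" by linarith
    have "real (\<Sum>j\<le>k. n choose j) * t ^ k = (\<Sum>j\<le>k. real (n choose j) * t ^ k)"
      by (simp add: sum_distrib_right)
    also have "\<dots> \<le> (\<Sum>j\<le>k. real (n choose j) * t ^ j)"
      using t by (intro sum_mono mult_left_mono power_decreasing) auto
    also have "\<dots> \<le> (\<Sum>j\<le>n. real (n choose j) * t ^ j)"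
      using kn t by (intro sum_mono2) auto
    also have "\<dots> = (t + 1) ^ n" by (simp add: binomial_ring)
    also have "\<dots> \<le> exp t ^ n"
      using t exp_ge_add_one_self[of t] by (intro power_mono) (auto simp: add.commute)
    also have "\<dots> = exp (t * real n)" by (simp add: exp_of_nat_mult[symmetric] mult.commute)
    finally have "real (\<Sum>j\<le>k. n choose j) \<le> exp (t * real n) * (1 / t) ^ k"
      using t by (simp add: field_simps power_divide)
    also have "(1 / t) ^ k = exp (real k * L)" by (simp add: exp_of_nat_mult L(2))
    also have "exp (t * real n) * exp (real k * L) = exp (t * real n + real k * L)"
      by (simp add: exp_add)
    also have "\<dots> \<le> exp (c * real n)"
    proof -
      have "real k * L \<le> \<kappa> * real n * L" using k L by (intro mult_right_mono) auto
      also have "\<dots> \<le> c / 2 * real n"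
        using mult_right_mono[OF \<kappa>L, of "real n"] by (simp add: algebra_simps)
      finally show ?thesis using mult_right_mono[OF t(3), of "real n"] by simp
    qed
    finally show ?thesis unfolding k_def .
  qed
  then show ?thesis using that \<kappa> by blast
qed

lemma card_subsets_of_bounded_card:
  "card {J. J \<subseteq> {..<n} \<and> card J \<le> d} = (\<Sum>j\<le>d. n choose j)"
proof -
  have "{J. J \<subseteq> {..<n} \<and> card J \<le> d} = (\<Union>j\<le>d. {J. J \<subseteq> {..<n} \<and> card J = j})" by auto
  also have "card \<dots> = (\<Sum>j\<le>d. card {J. J \<subseteq> {..<n} \<and> card J = j})"
    by (rule card_UN_disjoint) auto
  also have "\<dots> = (\<Sum>j\<le>d. n choose j)" by (simp add: n_subsets)
  finally show ?thesis .
qed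

text \<open>Two tail bounds are chained. The first picks \<open>\<kappa>\<close> so that sums up to
  \<open>\<kappa> * n\<close> are at most \<open>exp (c * n)\<close>; the second picks
  \<open>\<delta>\<close> so that at most \<open>2 powr (\<kappa> * n)\<close> sets have size up to
  \<open>\<delta> * n\<close>. Since \<open>\<delta>\<close> depends on \<open>c\<close> alone, one
  value serves all \<open>n\<close> and all members of a cover.\<close>

lemma subexponential_cover_of_patterns:
  assumes "0 < (c::real)"
  obtains \<delta> where "0 < \<delta>"
    "\<And>n (P :: nat \<Rightarrow> 'b \<Rightarrow> bool) Q E.
       (\<And>i x. \<not> (P i x \<and> Q i x)) \<Longrightarrow>
       (\<And>J. J \<subseteq> {..<n} \<Longrightarrow> shattered P Q E J \<Longrightarrow> real (card J) \<le> \<delta> * real n) \<Longrightarrow>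
       \<exists>W\<subseteq>Pow {..<n}. real (card W) \<le> exp (c * real n) \<and>
         (\<forall>x\<in>E. \<exists>w\<in>W. \<forall>i<n. if i \<in> w then \<not> P i x else \<not> Q i x)"
proof -
  obtain \<kappa> where \<kappa>: "0 < \<kappa>"
    "\<And>n. real (\<Sum>j\<le>nat \<lfloor>\<kappa> * real n\<rfloor>. n choose j) \<le> exp (c * real n)"
    using binomial_tail_small[OF assms] by blast
  have "0 < \<kappa> * ln 2" using \<kappa> by simp
  then obtain \<delta> where \<delta>: "0 < \<delta>"
    "\<And>n. real (\<Sum>j\<le>nat \<lfloor>\<delta> * real n\<rfloor>. n choose j) \<le> exp (\<kappa> * ln 2 * real n)"
    using binomial_tail_small by blast
  show ?thesis
  proof (rule that[OF \<delta>(1)])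
    fix n and P Q :: "nat \<Rightarrow> 'b \<Rightarrow> bool" and E
    assume disj: "\<And>i x. \<not> (P i x \<and> Q i x)"
      and small: "\<And>J. J \<subseteq> {..<n} \<Longrightarrow> shattered P Q E J \<Longrightarrow> real (card J) \<le> \<delta> * real n"
    define k where "k = nat \<lfloor>\<kappa> * real n\<rfloor>"
    have "card {J. J \<subseteq> {..<n} \<and> shattered P Q E J} \<le> card {J. J \<subseteq> {..<n} \<and> card J \<le> nat \<lfloor>\<delta> * real n\<rfloor>}"
      using small by (intro card_mono) (auto simp: le_nat_floor)
    then have "real (card {J. J \<subseteq> {..<n} \<and> shattered P Q E J}) \<le> exp (\<kappa> * ln 2 * real n)"
      using \<delta>(2)[of n] unfolding card_subsets_of_bounded_card by linarith
    \<comment> \<open>Rounding \<open>\<kappa> * n\<close> down to \<open>k\<close> makes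
      \<open>k + 1\<close> strictly larger, which yields the strict bound on the count.\<close>
    also have "\<dots> < exp (real (Suc k) * ln 2)"
    proof -
      have "\<kappa> * real n < real (Suc k)" using \<kappa>(1) unfolding k_def by linarith
      then have "\<kappa> * real n * ln 2 < real (Suc k) * ln 2" by (intro mult_strict_right_mono) auto
      then show ?thesis by (simp add: algebra_simps)
    qed
    also have "\<dots> = 2 ^ Suc k" by (subst exp_of_nat_mult) simp
    finally have "card {J. J \<subseteq> {..<n} \<and> shattered P Q E J} < 2 ^ Suc k"
      by (metis of_nat_less_numeral_power_cancel_iff)
    from small_cover_of_patterns[OF disj this] obtain W where W: "W \<subseteq> Pow {..<n}"
      "card W \<le> (\<Sum>j\<le>k. n choose j)"
      "\<forall>x\<in>E. \<exists>w\<in>W. \<forall>i<n. if i \<in> w then \<not> P i x else \<not> Q i x" by blast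
    have "real (card W) \<le> exp (c * real n)"
      using W(2) \<kappa>(2)[of n] unfolding k_def by linarith
    then show "\<exists>W\<subseteq>Pow {..<n}. real (card W) \<le> exp (c * real n) \<and>
         (\<forall>x\<in>E. \<exists>w\<in>W. \<forall>i<n. if i \<in> w then \<not> P i x else \<not> Q i x)"
      using W by blast
  qed
qed

section \<open>Independence sets from positive entropy\<close>

text \<open>The distances to the complements of the members have a continuous positive sum, with a
  positive minimum on \<open>X\<close>. At each point some distance is at least
  \<open>\<epsilon>\<close>, this minimum divided by the number of members; rescaling by
  \<open>\<epsilon>\<close> and cutting off at 1 gives the functions.\<close>

lemma compact_cover_urysohn:
  fixes X :: "'a::metric_space set"
  assumes X: "compact X" and U: "U \<in> fin_open_covers (top_of_set X)"
  obtains \<phi> :: "'a set \<Rightarrow> 'a \<Rightarrow> real" where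
    "\<And>V. continuous_on X (\<phi> V)" "\<And>V x. 0 \<le> \<phi> V x \<and> \<phi> V x \<le> 1"
    "\<And>V x. V \<in> U \<Longrightarrow> x \<in> X \<Longrightarrow> \<phi> V x \<noteq> 0 \<Longrightarrow> x \<in> V"
    "\<And>x. x \<in> X \<Longrightarrow> \<exists>V\<in>U. \<phi> V x = 1"
proof (cases "X = {}")
  case True
  then show ?thesis using that[of "\<lambda>_ _. 0"] by auto
next
  case False
  have U': "finite U" "\<And>V. V \<in> U \<Longrightarrow> openin (top_of_set X) V" "\<Union>U = X"
    using U by (auto simp: fin_open_covers_def)
  \<comment> \<open>\<open>infdist\<close> to the empty set is 0 by convention, so a member
    containing all of \<open>X\<close> gets the constant 1 instead.\<close>
  define d where "d = (\<lambda>V x. if X - V = {} then 1 else infdist x (X - V))"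
  have d_cont: "continuous_on X (d V)" for V
    unfolding d_def by (cases "X - V = {}") (simp_all add: continuous_on_infdist)
  have d_nonneg: "0 \<le> d V x" for V x by (auto simp: d_def infdist_nonneg)
  have d_in: "x \<in> V" if "x \<in> X" "d V x \<noteq> 0" for V x
    using that by (auto simp: d_def split: if_splits)
  have d_pos: "0 < d V x" if "V \<in> U" "x \<in> V" for V x
  proof (cases "X - V = {}")
    case False
    have "closedin (top_of_set X) (X - V)" using U'(2)[OF that(1)] by auto
    then have "closed (X - V)" using X closedin_closed_trans compact_imp_closed by blast
    then show ?thesis
      using False that infdist_pos_not_in_closed[of "X - V" x] by (simp add: d_def)
  qed (simp add: d_def)
  have "continuous_on X (\<lambda>x. \<Sum>V\<in>U. d V x)" by (intro continuous_on_sum d_cont)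
  then obtain x0 where x0: "x0 \<in> X" "\<And>x. x \<in> X \<Longrightarrow> (\<Sum>V\<in>U. d V x0) \<le> (\<Sum>V\<in>U. d V x)"
    using continuous_attains_inf[OF X False] by blast
  define \<sigma> where "\<sigma> = (\<Sum>V\<in>U. d V x0)"
  obtain V0 where "V0 \<in> U" "x0 \<in> V0" using x0(1) U'(3) by blast
  then have \<sigma>: "0 < \<sigma>"
    unfolding \<sigma>_def using U'(1) d_pos d_nonneg by (intro sum_pos2[of U V0]) auto
  have cU: "0 < card U" using U'(1) \<open>V0 \<in> U\<close> by (auto simp: card_gt_0_iff)
  define \<epsilon> where "\<epsilon> = \<sigma> / real (card U)"
  have \<epsilon>: "0 < \<epsilon>" using \<sigma> cU by (simp add: \<epsilon>_def)
  have big: "\<exists>V\<in>U. \<epsilon> \<le> d V x" if "x \<in> X" for x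
  proof (rule ccontr)
    assume "\<not> ?thesis"
    then have "(\<Sum>V\<in>U. d V x) < (\<Sum>V\<in>U. \<epsilon>)"
      using U'(1) \<open>V0 \<in> U\<close> by (intro sum_strict_mono) auto
    also have "\<dots> = \<sigma>" using cU by (simp add: \<epsilon>_def)
    finally show False using x0(2)[OF that] by (simp add: \<sigma>_def)
  qed
  show ?thesis
  proof (rule that[of "\<lambda>V x. min 1 (d V x / \<epsilon>)"])
    show "continuous_on X (\<lambda>x. min 1 (d V x / \<epsilon>))" for V
      using \<epsilon> by (intro continuous_intros d_cont) auto
    show "0 \<le> min 1 (d V x / \<epsilon>) \<and> min 1 (d V x / \<epsilon>) \<le> 1" for V x
      using d_nonneg \<epsilon> by auto
    show "x \<in> V" if "x \<in> X" "min 1 (d V x / \<epsilon>) \<noteq> 0" for V x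
      using that d_in[of x V] by (cases "d V x = 0") auto
    show "\<exists>V\<in>U. min 1 (d V x / \<epsilon>) = 1" if "x \<in> X" for x
      using big[OF that] \<epsilon> by (auto simp: min_def)
  qed
qed

lemma comp_upto_const: "comp_upto (\<lambda>n. f) k = f ^^ k"
  by (induction k) auto

lemma funpow_in: "f ` X \<subseteq> X \<Longrightarrow> x \<in> X \<Longrightarrow> (f ^^ k) x \<in> X"
  by (induction k) auto

text \<open>Each point has a tuple of patterns, one for every member of \<open>U\<close>. At every
  time below \<open>n\<close> some member has that time in its pattern, and this member contains the
  image of the point. One member of the join per tuple therefore suffices.\<close>

lemma cover_num_le_prod_patterns:
  fixes W :: "'b set \<Rightarrow> nat set set"
  assumes finU: "finite U" and finW: "\<And>V. V \<in> U \<Longrightarrow> finite (W V)"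
    and cov: "\<And>V x. V \<in> U \<Longrightarrow> x \<in> topspace T \<Longrightarrow>
       \<exists>w\<in>W V. \<forall>i<n. if i \<in> w then \<psi> i x \<in> V else \<not> Q V i x"
    and Q: "\<And>i x. i < n \<Longrightarrow> x \<in> topspace T \<Longrightarrow> \<exists>V\<in>U. Q V i x"
  shows "cover_num T (join_preimages T \<psi> n U) \<le> (\<Prod>V\<in>U. card (W V))"
proof -
  \<comment> \<open>The selection depends on the tuple and not on the point, so points with the same
    tuple share a member of the join.\<close>
  define c where "c = (\<lambda>(p :: 'b set \<Rightarrow> nat set) i. SOME V. V \<in> U \<and> i \<in> p V)"
  define D where "D = (\<lambda>p. topspace T \<inter> (\<Inter>i<n. \<psi> i -` c p i)) ` (\<Pi>\<^sub>E V\<in>U. W V)"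
  have fin: "finite (\<Pi>\<^sub>E V\<in>U. W V)" using finU finW by (intro finite_PiE) auto
  \<comment> \<open>A tuple that belongs to no point may select sets outside \<open>U\<close>;
    intersecting with the join discards it.\<close>
  have "cover_num T (join_preimages T \<psi> n U) \<le> card (D \<inter> join_preimages T \<psi> n U)"
  proof (rule cover_num_le_card)
    show "finite (join_preimages T \<psi> n U)" using finU by (rule finite_join_preimages)
    show "topspace T \<subseteq> \<Union>(D \<inter> join_preimages T \<psi> n U)"
    proof
      fix x assume x: "x \<in> topspace T"
      have "\<forall>V\<in>U. \<exists>w. w \<in> W V \<and> (\<forall>i<n. if i \<in> w then \<psi> i x \<in> V else \<not> Q V i x)"
        using cov x by blast
      then obtain q where q: "\<And>V. V \<in> U \<Longrightarrow> q V \<in> W V"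
        "\<And>V i. V \<in> U \<Longrightarrow> i < n \<Longrightarrow> (if i \<in> q V then \<psi> i x \<in> V else \<not> Q V i x)" by metis
      define p where "p = restrict q U"
      have p: "p \<in> (\<Pi>\<^sub>E V\<in>U. W V)" using q(1) by (auto simp: p_def)
      have c: "c p i \<in> U \<and> \<psi> i x \<in> c p i" if i: "i < n" for i
      proof -
        obtain V where "V \<in> U" "Q V i x" using Q[OF i x] by blast
        then have "V \<in> U \<and> i \<in> p V" using q(2)[of V i] i by (auto simp: p_def split: if_splits)
        then have "c p i \<in> U \<and> i \<in> p (c p i)"
          unfolding c_def by (rule someI[of "\<lambda>V. V \<in> U \<and> i \<in> p V"])
        then show ?thesis using q(2)[of "c p i" i] i by (auto simp: p_def split: if_splits)
      qed
      have "topspace T \<inter> (\<Inter>i<n. \<psi> i -` c p i) \<in> D \<inter> join_preimages T \<psi> n U"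
        unfolding D_def join_preimages_def using p c by blast
      moreover have "x \<in> topspace T \<inter> (\<Inter>i<n. \<psi> i -` c p i)" using x c by auto
      ultimately show "x \<in> \<Union>(D \<inter> join_preimages T \<psi> n U)" by blast
    qed
  qed auto
  also have "\<dots> \<le> card D" using fin by (intro card_mono) (auto simp: D_def)
  also have "\<dots> \<le> card (\<Pi>\<^sub>E V\<in>U. W V)" unfolding D_def by (rule card_image_le[OF fin])
  also have "\<dots> = (\<Prod>V\<in>U. card (W V))" using finU by (rule card_PiE)
  finally show ?thesis .
qed

text \<open>Fix a cover whose covering numbers grow at a rate above \<open>c\<close>. If dense
  shattered sets eventually disappeared for each of its members, every member would have few
  patterns, and the product of their numbers would bound the covering numbers by
  \<open>exp (c * n)\<close>.\<close>

lemma positive_entropy_shattered: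
  fixes X :: "'a::metric_space set"
  assumes X: "compact X" and f: "f ` X \<subseteq> X"
    and pos: "top_entropy (top_of_set X) (\<lambda>n. f) > 0"
  obtains \<phi> :: "'a \<Rightarrow> real" and \<delta> :: real where
    "continuous_on X \<phi>" "\<And>x. 0 \<le> \<phi> x \<and> \<phi> x \<le> 1" "0 < \<delta>"
    "\<exists>\<^sub>F n in sequentially. \<exists>J\<subseteq>{..<n}. \<delta> * real n < real (card J) \<and>
       shattered (\<lambda>i x. \<phi> ((f ^^ i) x) = 0) (\<lambda>i x. \<phi> ((f ^^ i) x) = 1) X J"
proof -
  let ?N = "\<lambda>U n. cover_num (top_of_set X) (join_preimages (top_of_set X) (\<lambda>i. f ^^ i) n U)"
  obtain U where U: "U \<in> fin_open_covers (top_of_set X)"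
    and limU: "0 < limsup (\<lambda>n. ereal (ln (real (?N U n)) / real n))"
    using pos unfolding top_entropy_def seq_entropy_def less_SUP_iff comp_upto_const by blast
  obtain c where c: "0 < c" "ereal c < limsup (\<lambda>n. ereal (ln (real (?N U n)) / real n))"
    using ereal_dense2[OF limU] by auto
  have freq: "\<exists>\<^sub>F n in sequentially. c < ln (real (?N U n)) / real n"
  proof (rule ccontr)
    assume "\<not> ?thesis"
    then have "\<forall>\<^sub>F n in sequentially. ereal (ln (real (?N U n)) / real n) \<le> ereal c"
      by (simp add: not_frequently not_less)
    then have "limsup (\<lambda>n. ereal (ln (real (?N U n)) / real n)) \<le> ereal c"
      by (rule Limsup_bounded)
    then show False using c(2) by simp
  qed
  have finU: "finite U" and covU: "\<Union>U = X" using U by (auto simp: fin_open_covers_def)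
  obtain \<phi> :: "'a set \<Rightarrow> 'a \<Rightarrow> real" where \<phi>: "\<And>V. continuous_on X (\<phi> V)"
    "\<And>V x. 0 \<le> \<phi> V x \<and> \<phi> V x \<le> 1"
    "\<And>V x. V \<in> U \<Longrightarrow> x \<in> X \<Longrightarrow> \<phi> V x \<noteq> 0 \<Longrightarrow> x \<in> V"
    "\<And>x. x \<in> X \<Longrightarrow> \<exists>V\<in>U. \<phi> V x = 1"
    using compact_cover_urysohn[OF X U] by blast
  define P where "P = (\<lambda>V i x. \<phi> V ((f ^^ i) x) = 0)"
  define Q where "Q = (\<lambda>V i x. \<phi> V ((f ^^ i) x) = 1)"
  \<comment> \<open>The product of \<open>card U\<close> factors \<open>exp (c' * n)\<close> stays
    within \<open>exp (c * n)\<close>; the \<open>+ 1\<close> keeps the denominator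
    positive.\<close>
  define c' where "c' = c / (real (card U) + 1)"
  have c': "0 < c'" using c by (simp add: c'_def add_nonneg_pos)
  obtain \<delta> where \<delta>: "0 < \<delta>" "\<And>n (P :: nat \<Rightarrow> 'a \<Rightarrow> bool) Q E.
       (\<And>i x. \<not> (P i x \<and> Q i x)) \<Longrightarrow>
       (\<And>J. J \<subseteq> {..<n} \<Longrightarrow> shattered P Q E J \<Longrightarrow> real (card J) \<le> \<delta> * real n) \<Longrightarrow>
       \<exists>W\<subseteq>Pow {..<n}. real (card W) \<le> exp (c' * real n) \<and>
         (\<forall>x\<in>E. \<exists>w\<in>W. \<forall>i<n. if i \<in> w then \<not> P i x else \<not> Q i x)"
    using subexponential_cover_of_patterns[OF c', where 'b = 'a] by blast
  have "\<exists>V\<in>U. \<exists>\<^sub>F n in sequentially. \<exists>J\<subseteq>{..<n}. \<delta> * real n < real (card J) \<and> shattered (P V) (Q V) X J"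
  proof (rule ccontr)
    assume "\<not> ?thesis"
    then have none: "\<forall>V\<in>U. \<forall>\<^sub>F n in sequentially. \<not> (\<exists>J\<subseteq>{..<n}. \<delta> * real n < real (card J) \<and> shattered (P V) (Q V) X J)"
      unfolding not_frequently[symmetric] by blast
    have "\<forall>\<^sub>F n in sequentially. \<forall>J\<subseteq>{..<n}. shattered (P V) (Q V) X J \<longrightarrow> real (card J) \<le> \<delta> * real n"
      if "V \<in> U" for V
      using bspec[OF none that] by (rule eventually_mono) (simp add: not_less[symmetric], metis)
    then have "\<forall>\<^sub>F n in sequentially. \<forall>V\<in>U. \<forall>J\<subseteq>{..<n}. shattered (P V) (Q V) X J \<longrightarrow> real (card J) \<le> \<delta> * real n"
      by (intro eventually_ball_finite finU ballI)
    then have "\<forall>\<^sub>F n in sequentially. \<not> c < ln (real (?N U n)) / real n"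
      using eventually_gt_at_top[of 0]
    proof eventually_elim
      case (elim n)
      have "\<exists>W\<subseteq>Pow {..<n}. real (card W) \<le> exp (c' * real n) \<and>
         (\<forall>x\<in>X. \<exists>w\<in>W. \<forall>i<n. if i \<in> w then \<not> P V i x else \<not> Q V i x)" if "V \<in> U" for V
        using elim that by (intro \<delta>(2)) (auto simp: P_def Q_def)
      then obtain W where W: "\<And>V. V \<in> U \<Longrightarrow> W V \<subseteq> Pow {..<n}"
        "\<And>V. V \<in> U \<Longrightarrow> real (card (W V)) \<le> exp (c' * real n)"
        "\<And>V x. V \<in> U \<Longrightarrow> x \<in> X \<Longrightarrow> \<exists>w\<in>W V. \<forall>i<n. if i \<in> w then \<not> P V i x else \<not> Q V i x"
        by metis
      have "?N U n \<le> (\<Prod>V\<in>U. card (W V))"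
      proof (rule cover_num_le_prod_patterns[OF finU, where Q = Q])
        show "finite (W V)" if "V \<in> U" for V using W(1)[OF that] finite_subset by blast
        show "\<exists>w\<in>W V. \<forall>i<n. if i \<in> w then (f ^^ i) x \<in> V else \<not> Q V i x"
          if "V \<in> U" "x \<in> topspace (top_of_set X)" for V x
        proof -
          have x: "x \<in> X" using that by simp
          obtain w where w: "w \<in> W V" "\<forall>i<n. if i \<in> w then \<not> P V i x else \<not> Q V i x"
            using W(3)[OF \<open>V \<in> U\<close> x] by blast
          have "(f ^^ i) x \<in> V" if "\<not> P V i x" for i
            using \<phi>(3)[OF \<open>V \<in> U\<close> funpow_in[OF f x]] that by (simp add: P_def)
          then show ?thesis using w by (intro bexI[of _ w]) (auto split: if_splits)
        qed
        show "\<exists>V\<in>U. Q V i x" if "x \<in> topspace (top_of_set X)" for i x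
          using \<phi>(4)[OF funpow_in[OF f, of x i]] that by (simp add: Q_def)
      qed
      then have "real (?N U n) \<le> (\<Prod>V\<in>U. real (card (W V)))"
        by (metis of_nat_le_iff of_nat_prod)
      also have "\<dots> \<le> (\<Prod>V\<in>U. exp (c' * real n))" by (intro prod_mono) (use W(2) in auto)
      also have "\<dots> = exp (real (card U) * (c' * real n))" by (simp add: exp_of_nat_mult)
      also have "\<dots> \<le> exp (c * real n)"
      proof -
        have "real (card U) * c' \<le> c" using c by (simp add: c'_def field_simps)
        then show ?thesis using mult_right_mono[of "real (card U) * c'" c "real n"]
          by (simp add: mult.assoc)
      qed
      finally have N: "real (?N U n) \<le> exp (c * real n)" .
      have "ln (real (?N U n)) \<le> c * real n"
      proof (cases "?N U n = 0")
        case False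
        then have "ln (real (?N U n)) \<le> ln (exp (c * real n))" using N by (intro ln_mono) auto
        then show ?thesis by simp
      qed (use c in auto)
      then show ?case using elim by (simp add: field_simps)
    qed
    then show False using freq by (simp add: not_frequently[symmetric])
  qed
  then obtain V where "\<exists>\<^sub>F n in sequentially. \<exists>J\<subseteq>{..<n}. \<delta> * real n < real (card J) \<and> shattered (P V) (Q V) X J"
    by blast
  then show ?thesis using that[of "\<phi> V" \<delta>] \<phi>(1,2) \<delta>(1) unfolding P_def Q_def by blast
qed

text \<open>Averaging over the translates of \<open>A ` {..<m}\<close> finds one that meets a dense shattered set
  in at least half the expected proportion.\<close>
lemma shattered_along_sequence:
  fixes \<phi> :: "'a \<Rightarrow> real" and A :: "nat \<Rightarrow> nat"
  assumes f: "f ` X \<subseteq> X" and \<delta>: "0 < \<delta>" and A: "strict_mono A"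
    and freq: "\<exists>\<^sub>F n in sequentially. \<exists>J\<subseteq>{..<n}. \<delta> * real n < real (card J) \<and>
       shattered (\<lambda>i x. \<phi> ((f ^^ i) x) = 0) (\<lambda>i x. \<phi> ((f ^^ i) x) = 1) X J"
  shows "\<exists>I\<subseteq>{..<m}. \<delta> / 2 * real m \<le> real (card I) \<and>
       shattered (\<lambda>i x. \<phi> ((f ^^ A i) x) = 0) (\<lambda>i x. \<phi> ((f ^^ A i) x) = 1) X I"
proof -
  \<comment> \<open>With \<open>A m\<close> below \<open>\<delta> / 2 * n\<close>, dropping the
    elements of \<open>J\<close> below \<open>A i\<close> still leaves at least half of the
    guaranteed \<open>\<delta> * n\<close>.\<close>
  obtain n J where n: "n > nat \<lceil>2 * real (A m) / \<delta>\<rceil>" and J: "J \<subseteq> {..<n}" "\<delta> * real n < real (card J)"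
    and sh: "shattered (\<lambda>i x. \<phi> ((f ^^ i) x) = 0) (\<lambda>i x. \<phi> ((f ^^ i) x) = 1) X J"
    using freq unfolding frequently_sequentially
    by (meson less_le_trans lessI)
  have finJ: "finite J" using J(1) finite_subset by blast
  have "2 * real (A m) / \<delta> < real n" using n by linarith
  then have Am: "real (A m) < \<delta> / 2 * real n" using \<delta> by (simp add: field_simps)
  define I where "I = (\<lambda>s. {i\<in>{..<m}. A i + s \<in> J})"
  have count: "\<delta> / 2 * real n \<le> real (card {s\<in>{..<n}. A i + s \<in> J})" if i: "i < m" for i
  proof -
    have "J - {..<A i} \<subseteq> (\<lambda>s. A i + s) ` {s\<in>{..<n}. A i + s \<in> J}"
    proof
      fix j assume "j \<in> J - {..<A i}"
      then have "j = A i + (j - A i)" "j - A i < n" "j \<in> J" using J(1) by auto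
      then show "j \<in> (\<lambda>s. A i + s) ` {s\<in>{..<n}. A i + s \<in> J}" by force
    qed
    then have "card (J - {..<A i}) \<le> card {s\<in>{..<n}. A i + s \<in> J}"
      by (rule surj_card_le[rotated]) simp
    moreover have "card J - A i \<le> card (J - {..<A i})"
      using diff_card_le_card_Diff[of "{..<A i}" J] by simp
    moreover have "A i \<le> A m" using A i by (simp add: strict_mono_less_eq)
    ultimately have "real (card J) - real (A m) \<le> real (card {s\<in>{..<n}. A i + s \<in> J})" by linarith
    then show ?thesis using J(2) Am by (simp add: field_simps)
  qed
  \<comment> \<open>Pairs \<open>(s, i)\<close> with \<open>A i + s \<in> J\<close> are counted in
    both orders: every \<open>i\<close> has at least \<open>\<delta> / 2 * n\<close> shifts, so some
    shift reaches the average.\<close>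
  have "\<exists>s<n. \<delta> / 2 * real m \<le> real (card (I s))"
  proof (rule ccontr)
    assume "\<not> ?thesis"
    then have less: "\<And>s. s < n \<Longrightarrow> real (card (I s)) < \<delta> / 2 * real m" by force
    have "(\<Sum>s<n. real (card (I s))) = (\<Sum>s<n. \<Sum>i<m. of_bool (A i + s \<in> J))"
      unfolding I_def by (simp add: Int_def)
    also have "\<dots> = (\<Sum>i<m. \<Sum>s<n. of_bool (A i + s \<in> J))" by (rule sum.swap)
    also have "\<dots> = (\<Sum>i<m. real (card {s\<in>{..<n}. A i + s \<in> J}))" by (simp add: Int_def)
    also have "\<dots> \<ge> (\<Sum>i<m. \<delta> / 2 * real n)" using count by (intro sum_mono) auto
    finally have "(\<Sum>s<n. real (card (I s))) \<ge> \<delta> / 2 * real m * real n" by (simp add: algebra_simps)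
    moreover have "(\<Sum>s<n. real (card (I s))) < (\<Sum>s<n. \<delta> / 2 * real m)"
      using less n by (intro sum_strict_mono) auto
    ultimately show False by (simp add: algebra_simps)
  qed
  then obtain s where s: "\<delta> / 2 * real m \<le> real (card (I s))" by blast
  have "shattered (\<lambda>i x. \<phi> ((f ^^ A i) x) = 0) (\<lambda>i x. \<phi> ((f ^^ A i) x) = 1) X (I s)"
    unfolding shattered_def
  proof (intro allI impI)
    fix K assume K: "K \<subseteq> I s"
    \<comment> \<open>Injectivity sends \<open>I s - K\<close> outside \<open>?K\<close>, so a point
      realising \<open>?K\<close> on \<open>J\<close> has the right value at every shifted time. Its
      image under \<open>f ^^ s\<close> is the witness.\<close>
    have injA: "A i = A j \<longleftrightarrow> i = j" for i j using A by (simp add: strict_mono_eq)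
    let ?K = "(\<lambda>i. A i + s) ` K"
    have "?K \<subseteq> J" using K by (auto simp: I_def)
    then obtain x where x: "x \<in> X" "\<forall>j\<in>?K. \<phi> ((f ^^ j) x) = 1" "\<forall>j\<in>J - ?K. \<phi> ((f ^^ j) x) = 0"
      using sh unfolding shattered_def by blast
    have "A i + s \<in> J - ?K" if "i \<in> I s - K" for i
      using that by (auto simp: I_def injA)
    then have "\<forall>j\<in>I s - K. \<phi> ((f ^^ (A j + s)) x) = 0" using x(3) by blast
    moreover have "\<forall>j\<in>K. \<phi> ((f ^^ (A j + s)) x) = 1" using x(2) by blast
    ultimately show "\<exists>x\<in>X. (\<forall>j\<in>K. \<phi> ((f ^^ A j) x) = 1) \<and> (\<forall>j\<in>I s - K. \<phi> ((f ^^ A j) x) = 0)"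
      using funpow_in[OF f x(1)] by (intro bexI[of _ "(f ^^ s) x"]) (auto simp: funpow_add)
  qed
  then show ?thesis using s by (intro exI[of _ "I s"]) (auto simp: I_def)
qed

section \<open>Induced maps on probability measures\<close>

lemma topspace_weak_star_top [simp]: "topspace (weak_star_top X) = prob_measures X"
proof -
  have "\<mu> \<in> \<Union>{{\<mu>. (\<integral>x. \<phi> x \<partial>\<mu>) \<in> V} | \<phi> V. continuous_on X \<phi> \<and> open (V::real set)}" for \<mu> :: "'a measure"
    \<comment> \<open>The constant function 0 with \<open>V = UNIV\<close> makes the whole type a
      subbasic set.\<close>
    by (rule UnionI[of UNIV]) (auto intro!: exI[of _ "\<lambda>_. 0"] exI[of _ UNIV])
  then show ?thesis unfolding weak_star_top_def topspace_subtopology topology_generated_by_topspace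
    by blast
qed

lemma continuous_map_weak_star_integral:
  assumes "continuous_on X (\<phi> :: 'a::topological_space \<Rightarrow> real)"
  shows "continuous_map (weak_star_top X) euclideanreal (\<lambda>\<mu>. \<integral>x. \<phi> x \<partial>\<mu>)"
  unfolding continuous_map_def
proof (intro conjI allI impI)
  fix V :: "real set" assume "openin euclideanreal V"
  then have "openin (topology_generated_by {{\<mu>. (\<integral>x. \<phi> x \<partial>\<mu>) \<in> V} | \<phi> V. continuous_on X \<phi> \<and> open (V::real set)})
     {\<mu>. (\<integral>x. \<phi> x \<partial>\<mu>) \<in> V}"
    using assms by (intro topology_generated_by_Basis) auto
  then show "openin (weak_star_top X) {\<mu> \<in> topspace (weak_star_top X). (\<integral>x. \<phi> x \<partial>\<mu>) \<in> V}"
    unfolding topspace_weak_star_top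
    by (subst weak_star_top_def) (auto simp: openin_subtopology)
qed auto

lemma measurable_restrict_borel_continuous:
  assumes "continuous_on X g" "g ` X \<subseteq> X"
  shows "g \<in> measurable (restrict_space borel X) (restrict_space borel X)"
  using assms by (intro measurable_restrict_space2)
    (auto simp: space_restrict_space intro: borel_measurable_continuous_on_restrict)

lemma induced_map_in_prob_measures:
  assumes "continuous_on X g" "g ` X \<subseteq> X" "\<mu> \<in> prob_measures X"
  shows "induced_map X g \<mu> \<in> prob_measures X"
proof -
  have "g \<in> measurable \<mu> (restrict_space borel X)"
    using measurable_restrict_borel_continuous[OF assms(1,2)] assms(3)
    by (auto simp: prob_measures_def cong: measurable_cong_sets)
  then show ?thesis using assms(3)
    by (auto simp: prob_measures_def induced_map_def intro: prob_space.prob_space_distr)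
qed

lemma comp_upto_continuous:
  assumes "\<And>n. continuous_on X (fs n)" "\<And>n. fs n ` X \<subseteq> X"
  shows "continuous_on X (comp_upto fs k) \<and> comp_upto fs k ` X \<subseteq> X"
proof (induction k)
  case (Suc k)
  then have "continuous_on X (fs k \<circ> comp_upto fs k)"
    using assms(1)[of k] by (intro continuous_on_compose) (auto intro: continuous_on_subset)
  then show ?case using assms(2)[of k] Suc by (auto simp: image_subset_iff)
qed auto

lemma comp_upto_induced_map:
  assumes fs: "\<And>n. continuous_on X (fs n)" "\<And>n. fs n ` X \<subseteq> X" and \<mu>: "\<mu> \<in> prob_measures X"
  shows "comp_upto (\<lambda>n. induced_map X (fs n)) k \<mu> = induced_map X (comp_upto fs k) \<mu>"
proof (induction k)
  case 0
  have "distr \<mu> (restrict_space borel X) (\<lambda>x. x) = \<mu>"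
    using \<mu> by (intro distr_id2) (simp add: prob_measures_def)
  then show ?case by (simp add: induced_map_def id_def)
next
  case (Suc k)
  have m: "fs k \<in> measurable (restrict_space borel X) (restrict_space borel X)"
    using fs by (rule measurable_restrict_borel_continuous)
  have "comp_upto fs k \<in> measurable (restrict_space borel X) (restrict_space borel X)"
    using comp_upto_continuous[OF fs] by (intro measurable_restrict_borel_continuous) auto
  then have "comp_upto fs k \<in> measurable \<mu> (restrict_space borel X)"
    using \<mu> by (auto simp: prob_measures_def cong: measurable_cong_sets)
  then show ?case using Suc m by (simp add: induced_map_def distr_distr comp_def)
qed

lemma integral_induced_map:
  assumes g: "continuous_on X g" "g ` X \<subseteq> X" and \<mu>: "\<mu> \<in> prob_measures X"
    and \<phi>: "continuous_on X (\<phi> :: _ \<Rightarrow> real)"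
  shows "(\<integral>x. \<phi> x \<partial>induced_map X g \<mu>) = (\<integral>x. \<phi> (g x) \<partial>\<mu>)"
proof -
  have "g \<in> measurable \<mu> (restrict_space borel X)"
    using measurable_restrict_borel_continuous[OF g] \<mu>
    by (auto simp: prob_measures_def cong: measurable_cong_sets)
  then show ?thesis unfolding induced_map_def
    using \<phi> by (intro integral_distr borel_measurable_continuous_on_restrict)
qed

text \<open>The measure is the image of the uniform distribution on the indices, so coinciding
  points count with multiplicity.\<close>

lemma uniform_measure_on_points:
  assumes m: "0 < m" and x: "\<And>l. l < m \<Longrightarrow> x l \<in> X"
  shows "\<exists>\<mu>\<in>prob_measures X. \<forall>\<phi> :: _ \<Rightarrow> real. continuous_on X \<phi> \<longrightarrow>
    real m * (\<integral>y. \<phi> y \<partial>\<mu>) = (\<Sum>l<m. \<phi> (x l))"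
proof -
  \<comment> \<open>The space of \<open>measure_pmf\<close> is the whole index type, so the map must
    land in \<open>X\<close> beyond \<open>m\<close> too.\<close>
  define y where "y = (\<lambda>l. if l < m then x l else x 0)"
  have y: "y l \<in> X" for l using x m by (simp add: y_def)
  define p where "p = pmf_of_set {..<m}"
  define \<mu> where "\<mu> = distr (measure_pmf p) (restrict_space borel X) y"
  have meas: "y \<in> measurable (measure_pmf p) (restrict_space borel X)"
    using y by (simp add: space_restrict_space)
  have "prob_space \<mu>" unfolding \<mu>_def using meas by (rule measure_pmf.prob_space_distr)
  then have "\<mu> \<in> prob_measures X" by (simp add: prob_measures_def \<mu>_def)
  moreover have "real m * (\<integral>y. \<phi> y \<partial>\<mu>) = (\<Sum>l<m. \<phi> (x l))" if "continuous_on X \<phi>" for \<phi> :: "_ \<Rightarrow> real"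
  proof -
    have "(\<integral>z. \<phi> z \<partial>\<mu>) = (\<integral>l. \<phi> (y l) \<partial>measure_pmf p)"
      unfolding \<mu>_def using meas that by (intro integral_distr borel_measurable_continuous_on_restrict)
    also have "\<dots> = (\<Sum>l<m. \<phi> (y l)) / real m"
      unfolding p_def using m by (subst integral_pmf_of_set) auto
    also have "(\<Sum>l<m. \<phi> (y l)) = (\<Sum>l<m. \<phi> (x l))" by (simp add: y_def)
    finally show ?thesis using m by simp
  qed
  ultimately show ?thesis by (intro bexI[of _ \<mu>] allI impI)
qed

lemma integral_in_unit_interval:
  assumes "\<mu> \<in> prob_measures X" "\<And>x. 0 \<le> \<phi> x \<and> \<phi> x \<le> (1::real)"
  shows "0 \<le> (\<integral>x. \<phi> x \<partial>\<mu>) \<and> (\<integral>x. \<phi> x \<partial>\<mu>) \<le> 1"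
proof -
  interpret prob_space \<mu> using assms by (simp add: prob_measures_def)
  \<comment> \<open>The integral of a non-integrable function is 0, which also satisfies the
    bound.\<close>
  have "(\<integral>x. \<phi> x \<partial>\<mu>) \<le> 1" using assms(2)
    by (cases "integrable \<mu> \<phi>") (auto intro!: integral_le_const simp: not_integrable_integral_eq)
  then show ?thesis using assms(2) by (auto intro: integral_nonneg_AE)
qed

text \<open>One function and one density serve every number of levels, so on measures the rates
  \<open>\<delta> / 2 * ln (m + 1)\<close> are unbounded.\<close>

lemma positive_seq_entropy_of_positive_entropy:
  fixes X :: "'a::metric_space set"
  assumes X: "compact X" and cont: "continuous_on X f" and f: "f ` X \<subseteq> X"
    and pos: "top_entropy (top_of_set X) (\<lambda>n. f) > 0" and A: "strict_mono A"
  shows "seq_entropy (top_of_set X) (\<lambda>n. f) A > 0"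
    and "seq_entropy (weak_star_top X) (\<lambda>n. induced_map X f) A = \<infinity>"
proof -
  obtain \<phi> :: "'a \<Rightarrow> real" and \<delta> :: real where \<phi>: "continuous_on X \<phi>"
    "\<And>x. 0 \<le> \<phi> x \<and> \<phi> x \<le> 1" and \<delta>: "0 < \<delta>"
    and freq: "\<exists>\<^sub>F n in sequentially. \<exists>J\<subseteq>{..<n}. \<delta> * real n < real (card J) \<and>
       shattered (\<lambda>i x. \<phi> ((f ^^ i) x) = 0) (\<lambda>i x. \<phi> ((f ^^ i) x) = 1) X J"
    using positive_entropy_shattered[OF X f pos] by blast
  note sh = shattered_along_sequence[OF f \<delta> A freq]
  have "ereal (\<delta> / 2 * ln (real 1 + 1)) \<le> seq_entropy (top_of_set X) (\<lambda>n. f) A"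
  proof (rule seq_entropy_ge[where h = \<phi>])
    show "continuous_map (top_of_set X) euclideanreal \<phi>" using \<phi>(1) by simp
    show "comp_upto (\<lambda>n. f) i z \<in> topspace (top_of_set X)" if "z \<in> topspace (top_of_set X)" for i z
      using that funpow_in[OF f] by (simp add: comp_upto_const)
    have "\<exists>J\<subseteq>{..<n}. \<delta> / 2 * real n \<le> real (card J) \<and>
       (\<forall>v\<in>J \<rightarrow>\<^sub>E {..1}. \<exists>z\<in>X. \<forall>j\<in>J. real 1 * \<phi> ((f ^^ A j) z) = real (v j))" for n
    proof -
      obtain I where I: "I \<subseteq> {..<n}" "\<delta> / 2 * real n \<le> real (card I)"
        "shattered (\<lambda>i x. \<phi> ((f ^^ A i) x) = 0) (\<lambda>i x. \<phi> ((f ^^ A i) x) = 1) X I"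
        using sh by blast
      have "\<exists>z\<in>X. \<forall>j\<in>I. real 1 * \<phi> ((f ^^ A j) z) = real (v j)" if v: "v \<in> I \<rightarrow>\<^sub>E {..1}" for v
      proof -
        have "{i\<in>I. v i = 1} \<subseteq> I" by blast
        then obtain z where z: "z \<in> X" "\<forall>j\<in>{i\<in>I. v i = 1}. \<phi> ((f ^^ A j) z) = 1"
          "\<forall>j\<in>I - {i\<in>I. v i = 1}. \<phi> ((f ^^ A j) z) = 0"
          using I(3) unfolding shattered_def by meson
        have "real 1 * \<phi> ((f ^^ A j) z) = real (v j)" if "j \<in> I" for j
        proof -
          have "v j \<in> {..1}" using v that by auto
          then have "v j = 0 \<or> v j = 1" by auto
          then show ?thesis using z that by auto
        qed
        then show ?thesis using z(1) by blast
      qed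
      then show ?thesis using I by blast
    qed
    then show "\<forall>\<^sub>F n in sequentially. \<exists>J\<subseteq>{..<n}. \<delta> / 2 * real n \<le> real (card J) \<and>
       (\<forall>v\<in>J \<rightarrow>\<^sub>E {..1}. \<exists>z\<in>topspace (top_of_set X).
          \<forall>j\<in>J. real 1 * \<phi> (comp_upto (\<lambda>n. f) (A j) z) = real (v j))"
      unfolding comp_upto_const by simp
  qed (use \<phi> in auto)
  moreover have "0 < \<delta> / 2 * ln (real 1 + 1)" using \<delta> by simp
  ultimately show "seq_entropy (top_of_set X) (\<lambda>n. f) A > 0"
    by (metis ereal_less(2) less_le_trans)
  have fk: "continuous_on X (f ^^ k)" "(f ^^ k) ` X \<subseteq> X" for k
    using comp_upto_continuous[of X "\<lambda>n. f" k] cont f by (auto simp: comp_upto_const)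
  have ge: "ereal (\<delta> / 2 * ln (real m + 1)) \<le> seq_entropy (weak_star_top X) (\<lambda>n. induced_map X f) A"
    if m: "0 < m" for m
  proof (rule seq_entropy_ge[where h = "\<lambda>\<mu>. \<integral>x. \<phi> x \<partial>\<mu>"])
    have comp: "comp_upto (\<lambda>n. induced_map X f) i \<mu> = induced_map X (f ^^ i) \<mu>"
      if "\<mu> \<in> prob_measures X" for i \<mu>
      using comp_upto_induced_map[of X "\<lambda>n. f", OF _ _ that] cont f by (simp add: comp_upto_const)
    show "continuous_map (weak_star_top X) euclideanreal (\<lambda>\<mu>. \<integral>x. \<phi> x \<partial>\<mu>)"
      by (rule continuous_map_weak_star_integral[OF \<phi>(1)])
    show "0 \<le> (\<integral>x. \<phi> x \<partial>z) \<and> (\<integral>x. \<phi> x \<partial>z) \<le> 1" if "z \<in> topspace (weak_star_top X)" for z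
      using that \<phi>(2) by (intro integral_in_unit_interval) auto
    show "comp_upto (\<lambda>n. induced_map X f) i z \<in> topspace (weak_star_top X)"
      if "z \<in> topspace (weak_star_top X)" for i z
      using that induced_map_in_prob_measures[OF fk] by (simp add: comp)
    show "0 < m" by fact
    have "\<exists>J\<subseteq>{..<n}. \<delta> / 2 * real n \<le> real (card J) \<and>
       (\<forall>v\<in>J \<rightarrow>\<^sub>E {..m}. \<exists>\<mu>\<in>prob_measures X.
          \<forall>j\<in>J. real m * (\<integral>x. \<phi> x \<partial>comp_upto (\<lambda>n. induced_map X f) (A j) \<mu>) = real (v j))" for n
    proof -
      obtain I where I: "I \<subseteq> {..<n}" "\<delta> / 2 * real n \<le> real (card I)"
        "shattered (\<lambda>i x. \<phi> ((f ^^ A i) x) = 0) (\<lambda>i x. \<phi> ((f ^^ A i) x) = 1) X I"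
        using sh by blast
      have "\<exists>\<mu>\<in>prob_measures X.
          \<forall>j\<in>I. real m * (\<integral>x. \<phi> x \<partial>comp_upto (\<lambda>n. induced_map X f) (A j) \<mu>) = real (v j)"
        if v: "v \<in> I \<rightarrow>\<^sub>E {..m}" for v
      proof -
        \<comment> \<open>Unary coding of the levels: at time \<open>j\<close> exactly the points
          with index \<open>l < v j\<close> have value 1. As \<open>v j \<le> m\<close>, these are
          \<open>v j\<close> of the \<open>m\<close> points, and the average is
          \<open>v j / m\<close>.\<close>
        have "\<exists>z. z \<in> X \<and> (\<forall>j\<in>I. \<phi> ((f ^^ A j) z) = of_bool (l < v j))" for l
        proof -
          have "{i\<in>I. l < v i} \<subseteq> I" by blast
          then obtain z where z: "z \<in> X" "\<forall>j\<in>{i\<in>I. l < v i}. \<phi> ((f ^^ A j) z) = 1"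
            "\<forall>j\<in>I - {i\<in>I. l < v i}. \<phi> ((f ^^ A j) z) = 0"
            using I(3) unfolding shattered_def by meson
          then show ?thesis by (intro exI[of _ z]) auto
        qed
        then obtain x where x: "\<And>l. x l \<in> X"
          "\<And>l j. j \<in> I \<Longrightarrow> \<phi> ((f ^^ A j) (x l)) = of_bool (l < v j)" by metis
        obtain \<mu> where \<mu>: "\<mu> \<in> prob_measures X"
          "\<forall>\<phi> :: _ \<Rightarrow> real. continuous_on X \<phi> \<longrightarrow> real m * (\<integral>y. \<phi> y \<partial>\<mu>) = (\<Sum>l<m. \<phi> (x l))"
          by (rule bexE[OF uniform_measure_on_points[of m x X, OF m x(1)]])
        have "real m * (\<integral>x. \<phi> x \<partial>comp_upto (\<lambda>n. induced_map X f) (A j) \<mu>) = real (v j)"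
          if j: "j \<in> I" for j
        proof -
          have "continuous_on X (\<lambda>x. \<phi> ((f ^^ A j) x))"
            using fk[of "A j"] by (intro continuous_on_compose2[OF \<phi>(1)]) auto
          then have "real m * (\<integral>x. \<phi> ((f ^^ A j) x) \<partial>\<mu>) = (\<Sum>l<m. \<phi> ((f ^^ A j) (x l)))"
            by (rule \<mu>(2)[rule_format])
          also have "\<dots> = (\<Sum>l<m. of_bool (l < v j))" using x(2)[OF j] by simp
          also have "\<dots> = real (card ({..<m} \<inter> {l. l < v j}))" by simp
          also have "{..<m} \<inter> {l. l < v j} = {..<v j}"
            using PiE_mem[OF v j] by auto
          finally show ?thesis
            using \<mu>(1) fk \<phi>(1) by (simp add: comp integral_induced_map)
        qed
        then show ?thesis using \<mu>(1) by blast
      qed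
      then show ?thesis using I by blast
    qed
    then show "\<forall>\<^sub>F n in sequentially. \<exists>J\<subseteq>{..<n}. \<delta> / 2 * real n \<le> real (card J) \<and>
       (\<forall>v\<in>J \<rightarrow>\<^sub>E {..m}. \<exists>z\<in>topspace (weak_star_top X).
          \<forall>j\<in>J. real m * (\<integral>x. \<phi> x \<partial>comp_upto (\<lambda>n. induced_map X f) (A j) z) = real (v j))"
      by simp
  qed
  show "seq_entropy (weak_star_top X) (\<lambda>n. induced_map X f) A = \<infinity>"
  proof (rule ereal_top)
    fix B :: real
    \<comment> \<open>Chosen so that \<open>ln m\<close> is at least
      \<open>2 * B / \<delta>\<close>, which lifts the rate above \<open>B\<close>.\<close>
    define m where "m = nat \<lceil>exp (2 * B / \<delta>)\<rceil>"
    have mB: "exp (2 * B / \<delta>) \<le> real m" unfolding m_def by linarith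
    then have "0 < m" using exp_gt_zero[of "2 * B / \<delta>"] by linarith
    have "2 * B / \<delta> = ln (exp (2 * B / \<delta>))" by simp
    also have "\<dots> \<le> ln (real m + 1)" using mB exp_gt_zero[of "2 * B / \<delta>"] by (intro ln_mono) linarith+
    finally have "B \<le> \<delta> / 2 * ln (real m + 1)" using \<delta> by (simp add: field_simps)
    then show "ereal B \<le> seq_entropy (weak_star_top X) (\<lambda>n. induced_map X f) A"
      using ge[OF \<open>0 < m\<close>] by (meson ereal_less_eq(3) order_trans)
  qed
qed

section \<open>Sequences of maps that collapse along a subsequence\<close>

lemma eventually_image_subset_open:
  assumes "uniform_limit X g (\<lambda>_. p) sequentially" "\<And>i. g i ` X \<subseteq> X"
    "openin (top_of_set X) V" "p \<in> V"
  shows "\<forall>\<^sub>F i in sequentially. g i ` X \<subseteq> V"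
proof -
  obtain e where e: "e > 0" "\<And>y. y \<in> X \<Longrightarrow> dist y p < e \<Longrightarrow> y \<in> V"
    using assms(3,4) unfolding openin_euclidean_subtopology_iff by blast
  have "\<forall>\<^sub>F i in sequentially. \<forall>x\<in>X. dist (g i x) p < e"
    using assms(1) e(1) unfolding uniform_limit_iff by blast
  then show ?thesis using assms(2) e(2) by (elim eventually_mono) blast
qed

text \<open>Uniform convergence to \<open>p\<close> carries all measures towards the Dirac measure
  at \<open>p\<close> simultaneously. The claim passes to finite intersections and to unions, so
  only subbasic sets need an estimate.\<close>

lemma eventually_induced_map_in_open:
  fixes X :: "'a::metric_space set"
  assumes lim: "uniform_limit X g (\<lambda>_. p) sequentially"
    and g: "\<And>i. continuous_on X (g i)" "\<And>i. g i ` X \<subseteq> X" and p: "p \<in> X"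
    and V: "openin (weak_star_top X) V" "return (restrict_space borel X) p \<in> V"
  shows "\<forall>\<^sub>F i in sequentially. \<forall>\<mu>\<in>prob_measures X. induced_map X (g i) \<mu> \<in> V"
proof -
  define B where "B = {{\<mu>. (\<integral>x. \<phi> x \<partial>\<mu>) \<in> V} | \<phi> V. continuous_on X \<phi> \<and> open (V::real set)}"
  have "\<forall>\<^sub>F i in sequentially. \<forall>\<mu>\<in>prob_measures X. induced_map X (g i) \<mu> \<in> S"
    if "generate_topology_on B S" "return (restrict_space borel X) p \<in> S" for S
    using that
  proof (induction rule: generate_topology_on.induct)
    case Empty
    then show ?case by simp
  next
    case (Int a b)
    then show ?case by (auto elim: eventually_elim2)
  next
    case (UN K)
    then obtain k where "k \<in> K" "return (restrict_space borel X) p \<in> k" by blast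
    then have "\<forall>\<^sub>F i in sequentially. \<forall>\<mu>\<in>prob_measures X. induced_map X (g i) \<mu> \<in> k"
      using UN.IH by blast
    then show ?case by (rule eventually_mono) (use \<open>k \<in> K\<close> in blast)
  next
    case (Basis s)
    then obtain \<phi> W where s: "s = {\<mu>. (\<integral>x. \<phi> x \<partial>\<mu>) \<in> W}" "continuous_on X \<phi>" "open (W::real set)"
      unfolding B_def by blast
    have \<phi>m: "\<phi> \<in> borel_measurable (restrict_space borel X)"
      using s(2) by (rule borel_measurable_continuous_on_restrict)
    have "\<phi> p \<in> W"
      using Basis.prems p \<phi>m unfolding s(1) by (simp add: integral_return space_restrict_space)
    then obtain e where e: "e > 0" "\<And>y. dist y (\<phi> p) < e \<Longrightarrow> y \<in> W"
      using s(3) unfolding open_dist by blast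
    \<comment> \<open>Half of \<open>e\<close> leaves room, since the pointwise bound is integrated
      as a non-strict one.\<close>
    obtain d where d: "d > 0" "\<And>x. x \<in> X \<Longrightarrow> dist x p < d \<Longrightarrow> dist (\<phi> x) (\<phi> p) < e / 2"
      using s(2) p e(1) unfolding continuous_on_iff by (metis half_gt_zero)
    have "\<forall>\<^sub>F i in sequentially. \<forall>x\<in>X. dist (g i x) p < d"
      using lim d(1) unfolding uniform_limit_iff by blast
    then show ?case
    proof (elim eventually_mono, intro ballI)
      fix i \<mu> assume i: "\<forall>x\<in>X. dist (g i x) p < d" and \<mu>: "\<mu> \<in> prob_measures X"
      interpret prob_space \<mu> using \<mu> by (simp add: prob_measures_def)
      have sets: "sets \<mu> = sets (restrict_space borel X)" using \<mu> by (simp add: prob_measures_def)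
      have space: "space \<mu> = X" using sets_eq_imp_space_eq[OF sets] by (simp add: space_restrict_space)
      have close: "\<bar>\<phi> (g i x) - \<phi> p\<bar> \<le> e / 2" if "x \<in> space \<mu>" for x
        using d(2)[of "g i x"] i g(2)[of i] that space by (auto simp: dist_real_def intro: less_imp_le)
      have "continuous_on X (\<lambda>x. \<phi> (g i x))"
        using g by (intro continuous_on_compose2[OF s(2)]) auto
      then have meas: "(\<lambda>x. \<phi> (g i x)) \<in> borel_measurable \<mu>"
        using borel_measurable_continuous_on_restrict sets by (metis measurable_cong_sets)
      \<comment> \<open>\<open>\<phi>\<close> may be unbounded on \<open>X\<close>, but its
        composition with \<open>g i\<close> stays within \<open>e / 2\<close> of
        \<open>\<phi> p\<close> and is thus bounded.\<close>
      have int: "integrable \<mu> (\<lambda>x. \<phi> (g i x))"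
      proof (rule integrable_const_bound[where B = "\<bar>\<phi> p\<bar> + e / 2"])
        show "AE x in \<mu>. norm (\<phi> (g i x)) \<le> \<bar>\<phi> p\<bar> + e / 2"
        proof (rule AE_I2)
          fix x assume "x \<in> space \<mu>"
          then show "norm (\<phi> (g i x)) \<le> \<bar>\<phi> p\<bar> + e / 2" using close[of x] unfolding real_norm_def by arith
        qed
      qed (rule meas)
      have le: "\<phi> (g i x) \<le> \<phi> p + e / 2" "\<phi> p - e / 2 \<le> \<phi> (g i x)" if "x \<in> space \<mu>" for x
        using close[OF that] by linarith+
      have "(\<integral>x. \<phi> (g i x) \<partial>\<mu>) \<le> \<phi> p + e / 2"
        using le(1) by (intro integral_le_const[OF int] AE_I2)
      moreover have "\<phi> p - e / 2 \<le> (\<integral>x. \<phi> (g i x) \<partial>\<mu>)"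
        using le(2) by (intro integral_ge_const[OF int] AE_I2)
      ultimately have "dist (\<integral>x. \<phi> (g i x) \<partial>\<mu>) (\<phi> p) < e"
        using e(1) by (simp add: dist_real_def abs_if)
      then show "induced_map X (g i) \<mu> \<in> s"
        unfolding s(1) using e(2) integral_induced_map[OF g(1,2) \<mu> s(2)] by simp
    qed
  qed
  moreover obtain S where "generate_topology_on B S" "V = S \<inter> prob_measures X"
    using V(1) unfolding weak_star_top_def openin_subtopology B_def openin_topology_generated_by_iff by blast
  ultimately have "\<forall>\<^sub>F i in sequentially. \<forall>\<mu>\<in>prob_measures X. induced_map X (g i) \<mu> \<in> S"
    using V(2) by blast
  then show ?thesis
    unfolding \<open>V = S \<inter> prob_measures X\<close>
    using induced_map_in_prob_measures[OF g] by (elim eventually_mono) blast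
qed

text \<open>Every cover has a member around \<open>p\<close>, and every cover of the space of
  measures has one around the Dirac measure at \<open>p\<close>. The collapse eventually moves the
  whole image into that member.\<close>

lemma seq_entropy_collapsing:
  fixes X :: "'a::metric_space set"
  assumes fs: "\<And>n. continuous_on X (fs n)" "\<And>n. fs n ` X \<subseteq> X"
    and p: "p \<in> X"
    and lim: "uniform_limit X (\<lambda>i. comp_upto fs (A i)) (\<lambda>_. p) sequentially"
  shows "seq_entropy (top_of_set X) fs A = 0"
    and "seq_entropy (weak_star_top X) (\<lambda>n. induced_map X (fs n)) A = 0"
proof -
  note c = comp_upto_continuous[of X fs, OF fs]
  have cc: "\<And>k. continuous_on X (comp_upto fs k)" "\<And>k. comp_upto fs k ` X \<subseteq> X" using c by auto
  show "seq_entropy (top_of_set X) fs A = 0"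
  proof (rule seq_entropy_eq_0_if_eventually_subordinate)
    fix U assume "U \<in> fin_open_covers (top_of_set X)"
    then obtain V where V: "V \<in> U" "p \<in> V" "openin (top_of_set X) V"
      using p by (auto simp: fin_open_covers_def)
    show "\<forall>\<^sub>F i in sequentially. \<exists>V\<in>U. comp_upto fs (A i) ` topspace (top_of_set X) \<subseteq> V"
      using eventually_image_subset_open[OF lim cc(2) V(3,2)] V(1) by (auto elim!: eventually_mono)
  qed (use cc in auto)
  show "seq_entropy (weak_star_top X) (\<lambda>n. induced_map X (fs n)) A = 0"
  proof (rule seq_entropy_eq_0_if_eventually_subordinate)
    show "comp_upto (\<lambda>n. induced_map X (fs n)) i z \<in> topspace (weak_star_top X)"
      if "z \<in> topspace (weak_star_top X)" for i z
      using that comp_upto_induced_map[OF fs] induced_map_in_prob_measures[OF cc] by simp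
    fix U assume U: "U \<in> fin_open_covers (weak_star_top X)"
    have "return (restrict_space borel X) p \<in> prob_measures X"
      using p by (simp add: prob_measures_def prob_space_return space_restrict_space)
    then obtain V where V: "V \<in> U" "return (restrict_space borel X) p \<in> V" "openin (weak_star_top X) V"
      using U by (auto simp: fin_open_covers_def)
    show "\<forall>\<^sub>F i in sequentially. \<exists>V\<in>U.
        comp_upto (\<lambda>n. induced_map X (fs n)) (A i) ` topspace (weak_star_top X) \<subseteq> V"
      using eventually_induced_map_in_open[OF lim cc p V(3,2)]
      by (rule eventually_mono) (use V(1) comp_upto_induced_map[OF fs] in auto)
  qed
qed

section \<open>A rescaled horseshoe map on the unit interval\<close>

definition tent3 :: "real \<Rightarrow> real" where
  "tent3 x = min 1 (min (3 * x) (3 - 3 * x))"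

text \<open>Map \<open>2 * i\<close> multiplies by \<open>i + 1\<close> and so undoes the
  contraction made just before; map \<open>2 * i + 1\<close> applies the tent map and divides by
  \<open>i + 2\<close>. The cut-off at 1 keeps the first kind inside the interval and is inactive
  along orbits that start at time 0. The first factor is 1, as nothing has been contracted
  yet.\<close>

definition scaled_tent3 :: "nat \<Rightarrow> real \<Rightarrow> real" where
  "scaled_tent3 n x = (if even n then min 1 ((real (n div 2) + 1) * x)
     else tent3 x / (real (n div 2) + 2))"

lemma tent3_in: "x \<in> {0..1} \<Longrightarrow> tent3 x \<in> {0..1}"
  by (auto simp: tent3_def)

lemma tent3_pow_in: "x \<in> {0..1} \<Longrightarrow> (tent3 ^^ k) x \<in> {0..1}"
  using funpow_in[of tent3 "{0..1}" x k] tent3_in by blast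

lemma scaled_tent3_continuous: "continuous_on {0..1} (scaled_tent3 n)"
proof (cases "even n")
  case True
  then have "scaled_tent3 n = (\<lambda>x. min 1 ((real (n div 2) + 1) * x))"
    by (simp add: scaled_tent3_def fun_eq_iff)
  then show ?thesis by (auto intro!: continuous_intros)
next
  case False
  then have "scaled_tent3 n = (\<lambda>x. min 1 (min (3 * x) (3 - 3 * x)) / (real (n div 2) + 2))"
    by (simp add: scaled_tent3_def tent3_def fun_eq_iff)
  then show ?thesis by (auto intro!: continuous_intros)
qed

lemma scaled_tent3_in: "scaled_tent3 n ` {0..1} \<subseteq> {0..1}"
proof
  fix y assume "y \<in> scaled_tent3 n ` {0..1}"
  then obtain x where x: "x \<in> {0..1}" "y = scaled_tent3 n x" by blast
  then show "y \<in> {0..1}" using tent3_in[OF x(1)]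
    by (auto simp: scaled_tent3_def field_simps)
qed

text \<open>The formula for even times is a hypothesis so that this fact can be used within the
  induction that proves it. The cut-off is inactive because iterates of \<open>tent3\<close> stay at
  most 1.\<close>

lemma comp_upto_scaled_tent3_odd:
  assumes "comp_upto scaled_tent3 (2 * i) x = (tent3 ^^ i) x / (real i + 1)" "x \<in> {0..1}"
  shows "comp_upto scaled_tent3 (2 * i + 1) x = (tent3 ^^ i) x"
proof -
  have "real i + 1 \<noteq> 0" by linarith
  then show ?thesis
    using assms(1) tent3_pow_in[OF assms(2), of i] by (simp add: scaled_tent3_def)
qed

lemma comp_upto_scaled_tent3_even:
  assumes "x \<in> {0..1}"
  shows "comp_upto scaled_tent3 (2 * i) x = (tent3 ^^ i) x / (real i + 1)"
proof (induction i)
  case (Suc i)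
  have "comp_upto scaled_tent3 (2 * Suc i) x = scaled_tent3 (2 * i + 1) (comp_upto scaled_tent3 (2 * i + 1) x)"
    by simp
  also have "\<dots> = tent3 ((tent3 ^^ i) x) / (real i + 2)"
    unfolding comp_upto_scaled_tent3_odd[OF Suc assms] by (simp add: scaled_tent3_def)
  finally show ?case by (simp add: algebra_simps)
qed simp

text \<open>The observed function is 0 on the left third and 1 on the right third, and
  \<open>tent3\<close> maps each of these thirds onto the whole interval. A symbol is prepended to a
  realised pattern by taking the preimage in the corresponding third.\<close>

lemma tent3_realizes_patterns:
  "\<exists>x\<in>{0..1}. \<forall>i<k. max 0 (min 1 (3 * (tent3 ^^ i) x - 1)) = of_bool (\<sigma> i)"
proof (induction k arbitrary: \<sigma>)
  case 0
  show ?case by (intro bexI[of _ 0]) auto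
next
  case (Suc k)
  obtain y where y: "y \<in> {0..1}"
    "\<And>i. i < k \<Longrightarrow> max 0 (min 1 (3 * (tent3 ^^ i) y - 1)) = of_bool (\<sigma> (Suc i))"
    using Suc[of "\<lambda>i. \<sigma> (Suc i)"] by blast
  define x where "x = (if \<sigma> 0 then 1 - y / 3 else y / 3)"
  have x: "x \<in> {0..1}" "tent3 x = y" "max 0 (min 1 (3 * x - 1)) = of_bool (\<sigma> 0)"
    using y(1) by (auto simp: x_def tent3_def)
  have "max 0 (min 1 (3 * (tent3 ^^ i) x - 1)) = of_bool (\<sigma> i)" if "i < Suc k" for i
    using that x y(2) by (cases i) (simp_all add: funpow_swap1)
  then show ?case using x(1) by blast
qed

lemma scaled_tent3_top_entropy_pos: "top_entropy (top_of_set {0..1}) scaled_tent3 > 0"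
proof -
  define h where "h = (\<lambda>x::real. max 0 (min 1 (3 * x - 1)))"
  have "ereal (1 / 4 * ln (real 1 + 1)) \<le> seq_entropy (top_of_set {0..1}) scaled_tent3 (\<lambda>i. i)"
  proof (rule seq_entropy_ge[where h = h])
    show "continuous_map (top_of_set {0..1}) euclideanreal h"
      unfolding h_def by (auto intro!: continuous_intros)
    show "comp_upto scaled_tent3 i z \<in> topspace (top_of_set {0..1})"
      if "z \<in> topspace (top_of_set {0..1})" for i z
      using comp_upto_continuous[of "{0..1}" scaled_tent3 i, OF scaled_tent3_continuous scaled_tent3_in] that
      unfolding topspace_euclidean_subtopology by blast
    show "\<forall>\<^sub>F n in sequentially. \<exists>J\<subseteq>{..<n}. 1 / 4 * real n \<le> real (card J) \<and>
       (\<forall>v\<in>J \<rightarrow>\<^sub>E {..1}. \<exists>z\<in>topspace (top_of_set {0..1}).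
          \<forall>j\<in>J. real 1 * h (comp_upto scaled_tent3 j z) = real (v j))"
      using eventually_ge_at_top[of 2]
    proof eventually_elim
      case (elim n)
      \<comment> \<open>At odd times the compositions are unscaled iterates of \<open>tent3\<close>.
        There are \<open>n div 2\<close> of them below \<open>n\<close>, at least a quarter of all
        times once \<open>n \<ge> 2\<close>.\<close>
      define J where "J = (\<lambda>i. 2 * i + 1) ` {..<n div 2}"
      have "card J = n div 2" unfolding J_def by (subst card_image) (auto simp: inj_on_def)
      then have "1 / 4 * real n \<le> real (card J)" using elim by linarith
      moreover have "J \<subseteq> {..<n}" by (auto simp: J_def)
      moreover have "\<exists>z\<in>{0..1}. \<forall>j\<in>J. real 1 * h (comp_upto scaled_tent3 j z) = real (v j)"
        if v: "v \<in> J \<rightarrow>\<^sub>E {..1}" for v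
      proof -
        obtain z where z: "z \<in> {0..1}"
          "\<And>i. i < n div 2 \<Longrightarrow> h ((tent3 ^^ i) z) = of_bool (v (2 * i + 1) = 1)"
          using tent3_realizes_patterns[of "n div 2" "\<lambda>i. v (2 * i + 1) = 1"] unfolding h_def by blast
        have "real 1 * h (comp_upto scaled_tent3 j z) = real (v j)" if j: "j \<in> J" for j
        proof -
          obtain i where i: "i < n div 2" "j = 2 * i + 1" using j by (auto simp: J_def)
          have "v j \<in> {..1}" using v j by auto
          then have "v j = 0 \<or> v j = 1" by auto
          then show ?thesis
            using z(2)[OF i(1)] comp_upto_scaled_tent3_odd[OF comp_upto_scaled_tent3_even[OF z(1)] z(1), of i]
            unfolding i(2) by auto
        qed
        then show ?thesis using z(1) by blast
      qed
      ultimately show ?case by (intro exI[of _ J]) simp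
    qed
  qed (auto simp: h_def)
  moreover have "0 < 1 / 4 * ln (real 1 + 1)" by simp
  ultimately show ?thesis unfolding top_entropy_def by (metis ereal_less(2) less_le_trans)
qed

lemma scaled_tent3_collapses:
  "uniform_limit {0..1} (\<lambda>i. comp_upto scaled_tent3 (2 * i)) (\<lambda>_. 0) sequentially"
  unfolding uniform_limit_iff
proof (intro allI impI)
  fix e :: real assume "e > 0"
  have "(\<lambda>i. 1 / (real i + 1)) \<longlonglongrightarrow> 0"
    using LIMSEQ_inverse_real_of_nat by (simp add: inverse_eq_divide add.commute)
  then have "\<forall>\<^sub>F i in sequentially. 1 / (real i + 1) < e"
    using \<open>e > 0\<close> by (rule order_tendstoD)
  then show "\<forall>\<^sub>F i in sequentially. \<forall>x\<in>{0..1}. dist (comp_upto scaled_tent3 (2 * i) x) 0 < e"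
  proof (elim eventually_mono, intro ballI)
    fix i and x :: real assume i: "1 / (real i + 1) < e" and x: "x \<in> {0..1}"
    have "(tent3 ^^ i) x / (real i + 1) \<le> 1 / (real i + 1)"
      using tent3_pow_in[OF x, of i] by (intro divide_right_mono) auto
    then show "dist (comp_upto scaled_tent3 (2 * i) x) 0 < e"
      using i tent3_pow_in[OF x, of i] unfolding comp_upto_scaled_tent3_even[OF x]
      by (simp add: dist_real_def)
  qed
qed

theorem theorem5p6:
  fixes X :: "'a::metric_space set" and f :: "'a \<Rightarrow> 'a"
  shows
   "(compact X \<and> continuous_on X f \<and> f ` X = X \<and> top_entropy (top_of_set X) (\<lambda>n. f) > 0 \<longrightarrow>
      (\<forall>A. strict_mono A \<longrightarrow>
          seq_entropy (top_of_set X) (\<lambda>n. f) A > 0 \<and>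
          seq_entropy (weak_star_top X) (\<lambda>n. induced_map X f) A = \<infinity>))
    \<and>
    (\<exists>fs :: nat \<Rightarrow> real \<Rightarrow> real.
        (\<forall>n. continuous_on {0..1} (fs n) \<and> fs n ` {0..1} \<subseteq> {0..1}) \<and>
        top_entropy (top_of_set {0..1}) fs > 0 \<and>
        (\<exists>A. strict_mono A \<and>
             seq_entropy (top_of_set {0..1}) fs A = 0 \<and>
             seq_entropy (weak_star_top {0..1}) (\<lambda>n. induced_map {0..1} (fs n)) A = 0))"
proof (intro conjI impI allI)
  fix A :: "nat \<Rightarrow> nat"
  assume "compact X \<and> continuous_on X f \<and> f ` X = X \<and> top_entropy (top_of_set X) (\<lambda>n. f) > 0"
    and "strict_mono A"
  then show "seq_entropy (top_of_set X) (\<lambda>n. f) A > 0"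
    and "seq_entropy (weak_star_top X) (\<lambda>n. induced_map X f) A = \<infinity>"
    by (auto intro!: positive_seq_entropy_of_positive_entropy)
next
  \<comment> \<open>The even times are those at which the compositions carry the vanishing factor
    \<open>1 / (i + 1)\<close>.\<close>
  have "strict_mono (\<lambda>i::nat. 2 * i)" by (simp add: strict_mono_def)
  moreover note seq_entropy_collapsing[OF scaled_tent3_continuous scaled_tent3_in _ scaled_tent3_collapses, simplified]
  ultimately have "\<exists>A. strict_mono A \<and> seq_entropy (top_of_set {0..1}) scaled_tent3 A = 0 \<and>
      seq_entropy (weak_star_top {0..1}) (\<lambda>n. induced_map {0..1} (scaled_tent3 n)) A = 0" by blast
  then show "\<exists>fs :: nat \<Rightarrow> real \<Rightarrow> real.
        (\<forall>n. continuous_on {0..1} (fs n) \<and> fs n ` {0..1} \<subseteq> {0..1}) \<and>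
        top_entropy (top_of_set {0..1}) fs > 0 \<and>
        (\<exists>A. strict_mono A \<and>
             seq_entropy (top_of_set {0..1}) fs A = 0 \<and>
             seq_entropy (weak_star_top {0..1}) (\<lambda>n. induced_map {0..1} (fs n)) A = 0)"
    using scaled_tent3_continuous scaled_tent3_in scaled_tent3_top_entropy_pos by blast
qed

end
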